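(* Let $(U_-,X_-,X_+)$ be a data triplet sampled from a state-space model of dimension $N$ (discrete time or continuous time, initial-condition subspace $\mathcal X_0\subset\mathbb R^N$) for which the low-dimensionality property with respect to a full-rank matrix $V\in\mathbb R^{N\times n}$ holds. Let $\widehat X_-,\widehat X_+\in\mathbb R^{n\times T}$ be the reduced data matrices defined by $X_-=V\widehat X_-$ and $X_+=V\widehat X_+$. Then there exists a controller $K\in\mathbb R^{p\times N}$ such that $\Sigma_{\mathrm{i/s}}^{\mathrm s}(V)\subseteq\Sigma_K$ if and only if the reduced data triplet $(U_-,\widehat X_-,\widehat X_+)$ is informative for stabilization by feedback, i.e., there exists $\widehat K\in\mathbb R^{p\times n}$ with $\widehat\Sigma_{\mathrm{i/s}}\subseteq\widehat\Sigma_{\widehat K}$. In this case, for any such $\widehat K$, a controller with $\Sigma_{\mathrm{i/s}}^{\mathrm s}(V)\subseteq\Sigma_K$ is given by $K=\widehat K V^\dagger$ for every left inverse $V^\dagger$ of $V$.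
   Context: State-space models: a pair $(A,B)$, $A\in\mathbb R^{N\times N}$, $B\in\mathbb R^{N\times p}$, with dynamics $x(t+1)=Ax(t)+Bu(t)$, $t\in\mathbb N_0$ (discrete time) or $\dot x(t)=Ax(t)+Bu(t)$, $t\ge 0$ (continuous time), and initial conditions $x(0)$ in a fixed linear subspace $\mathcal X_0\subset\mathbb R^N$. A square matrix is (asymptotically) stable if its eigenvalues lie in the open unit disk (discrete time) or in the open left half-plane (continuous time). Data triplet: $X_-,X_+\in\mathbb R^{N\times T}$, $U_-\in\mathbb R^{p\times T}$. In discrete time $X_-=[x(0),\dots,x(T-1)]$, $X_+=[x(1),\dots,x(T)]$, $U_-=[u(0),\dots,u(T-1)]$; in continuous time, for times $0=t_0<\dots<t_{T-1}$, $X_-=[x(t_0),\dots,x(t_{T-1})]$, $X_+=[\dot x(t_0),\dots,\dot x(t_{T-1})]$, $U_-=[u(t_0),\dots,u(t_{T-1})]$. Here $x$ is the trajectory for some input $u$ and some $x(0)\in\mathcal X_0$. In particular $X_+=AX_-+BU_-$ for the model that generated the data. Low-dimensionality property of a model $(A,B)$ with respect to a full-rank $V\in\mathbb R^{N\times n}$, $n\le N$: for all $x(0)\in\mathcal X_0$ and all inputs $u$ there exist $\hat x(t)\in\mathbb R^n$ with $x(t)=V\hat x(t)$ for all $t\ge0$; equivalently, there is an $n$-dimensional state-space model $(\widehat A,\widehat B)$ whose states $\hat x(t)$ (same inputs, $x(0)=V\hat x(0)$) satisfy $x(t)=V\hat x(t)$ for all $t\geq 0$. Sets of models: $\Sigma_{\mathrm{i/s}}=\{(A,B):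 X_+=AX_-+BU_-\}$; $\Sigma_K=\{(A,B): A+BK \text{ is asymptotically stable}\}$; $\widehat\Sigma_{\mathrm{i/s}}=\{(\widehat A,\widehat B)\in\mathbb R^{n\times n}\times\mathbb R^{n\times p}:\widehat X_+=\widehat A\widehat X_-+\widehat BU_-\}$; $\widehat\Sigma_{\widehat K}=\{(\widehat A,\widehat B):\widehat A+\widehat B\widehat K\text{ is asymptotically stable}\}$. Let $V_\perp$ be a basis matrix of the orthogonal complement of the column span of $V$ in $\mathbb R^N$, and $V_\perp^\dagger$ its Moore–Penrose inverse (so $V_\perp^\dagger V_\perp=I$, $V_\perp^\dagger V=0$). Then $\Sigma^{\mathrm s}_{\mathrm{i/s}}(V)$ is the set of all $(A,B)\in\Sigma_{\mathrm{i/s}}$ such that (i) $(A,B)$ (with the initial-condition subspace $\mathcal X_0$) has the low-dimensionality property with respect to $V$, and (ii) $V_\perp^\dagger AV_\perp$ is stable. *)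

theory Defs
  imports
    "Jordan_Normal_Form.DL_Rank"
    "Jordan_Normal_Form.Char_Poly"
begin

datatype time_domain = Discrete | Continuous

(* Asymptotic stability; the eigenvalues of a real matrix are those of its complexification.
   A 0 x 0 matrix has no eigenvalue, hence is stable. *)
definition stable :: "time_domain \<Rightarrow> real mat \<Rightarrow> bool" where
  "stable td M \<longleftrightarrow>
     (\<forall>z. eigenvalue (map_mat complex_of_real M) z \<longrightarrow>
        (case td of Discrete \<Rightarrow> cmod z < 1 | Continuous \<Rightarrow> Re z < 0))"

(* x(t+1) = A x(t) + B u(t) *)
definition trajectory_dt ::
  "nat \<Rightarrow> nat \<Rightarrow> real mat \<Rightarrow> real mat \<Rightarrow> (nat \<Rightarrow> real vec) \<Rightarrow> (nat \<Rightarrow> real vec) \<Rightarrow> bool" where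
  "trajectory_dt N p A B u x \<longleftrightarrow>
     (\<forall>t. u t \<in> carrier_vec p \<and> x t \<in> carrier_vec N \<and>
          x (Suc t) = A *\<^sub>v x t + B *\<^sub>v u t)"

(* Derivative, on the time axis [0, infinity), of a curve in R^N (one-sided at time 0);
   componentwise, as the type of vectors of variable length is not a normed space. *)
definition has_velocity :: "nat \<Rightarrow> (real \<Rightarrow> real vec) \<Rightarrow> real vec \<Rightarrow> real \<Rightarrow> bool" where
  "has_velocity N x v t \<longleftrightarrow> v \<in> carrier_vec N \<and>
     (\<forall>i<N. ((\<lambda>s. x s $ i) has_real_derivative v $ i) (at t within {0..}))"

(* x'(t) = A x(t) + B u(t) in the classical sense at every t >= 0.  The input u is not
   restricted beyond this; in particular all continuous inputs are covered. *)
definition trajectory_ct ::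
  "nat \<Rightarrow> nat \<Rightarrow> real mat \<Rightarrow> real mat \<Rightarrow> (real \<Rightarrow> real vec) \<Rightarrow> (real \<Rightarrow> real vec) \<Rightarrow> bool" where
  "trajectory_ct N p A B u x \<longleftrightarrow>
     (\<forall>t\<ge>0. u t \<in> carrier_vec p \<and> x t \<in> carrier_vec N \<and>
            has_velocity N x (A *\<^sub>v x t + B *\<^sub>v u t) t)"

definition data_sampled ::
  "time_domain \<Rightarrow> nat \<Rightarrow> nat \<Rightarrow> nat \<Rightarrow> real vec set \<Rightarrow> real mat \<Rightarrow> real mat \<Rightarrow>
   real mat \<Rightarrow> real mat \<Rightarrow> real mat \<Rightarrow> bool" where
  "data_sampled td N p T X0 A B U Xm Xp \<longleftrightarrow>
    (case td of
      Discrete \<Rightarrow>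
        (\<exists>u x. trajectory_dt N p A B u x \<and> x 0 \<in> X0 \<and>
           U = mat_of_cols p (map u [0..<T]) \<and>
           Xm = mat_of_cols N (map x [0..<T]) \<and>
           Xp = mat_of_cols N (map (\<lambda>j. x (Suc j)) [0..<T]))
    | Continuous \<Rightarrow>
        (\<exists>u x (\<tau> :: nat \<Rightarrow> real) xd.
           trajectory_ct N p A B u x \<and> x 0 \<in> X0 \<and>
           \<tau> 0 = 0 \<and> (\<forall>i j. i < j \<and> j < T \<longrightarrow> \<tau> i < \<tau> j) \<and>
           (\<forall>j<T. has_velocity N x (xd j) (\<tau> j)) \<and>
           U = mat_of_cols p (map (\<lambda>j. u (\<tau> j)) [0..<T]) \<and>
           Xm = mat_of_cols N (map (\<lambda>j. x (\<tau> j)) [0..<T]) \<and>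
           Xp = mat_of_cols N (map xd [0..<T])))"

definition low_dimensional ::
  "time_domain \<Rightarrow> nat \<Rightarrow> nat \<Rightarrow> nat \<Rightarrow> real vec set \<Rightarrow> real mat \<Rightarrow> real mat \<Rightarrow> real mat \<Rightarrow> bool" where
  "low_dimensional td N p n X0 V A B \<longleftrightarrow>
    (case td of
      Discrete \<Rightarrow>
        (\<forall>u x. trajectory_dt N p A B u x \<and> x 0 \<in> X0 \<longrightarrow>
           (\<exists>xh. \<forall>t. xh t \<in> carrier_vec n \<and> x t = V *\<^sub>v xh t))
    | Continuous \<Rightarrow>
        (\<forall>u x. trajectory_ct N p A B u x \<and> x 0 \<in> X0 \<longrightarrow>
           (\<exists>xh. \<forall>t\<ge>0. xh t \<in> carrier_vec n \<and> x t = V *\<^sub>v xh t)))"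

definition linear_subspace :: "nat \<Rightarrow> real vec set \<Rightarrow> bool" where
  "linear_subspace N W \<longleftrightarrow> VectorSpace.subspace class_ring W (module_vec TYPE(real) N)"

definition basis_matrix :: "nat \<Rightarrow> real vec set \<Rightarrow> real mat \<Rightarrow> bool" where
  "basis_matrix N W M \<longleftrightarrow> dim_row M = N \<and> distinct (cols M) \<and>
     module.lin_indpt class_ring (module_vec TYPE(real) N) (set (cols M)) \<and>
     vec_space.col_space N M = W"

(* Moore-Penrose inverse, as the unique solution of the four Penrose equations *)
definition mp_inverse :: "real mat \<Rightarrow> real mat" where
  "mp_inverse M = (THE P. P \<in> carrier_mat (dim_col M) (dim_row M) \<and>
     M * P * M = M \<and> P * M * P = P \<and>
     transpose_mat (M * P) = M * P \<and> transpose_mat (P * M) = P * M)"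

definition Sigma_is ::
  "nat \<Rightarrow> nat \<Rightarrow> real mat \<Rightarrow> real mat \<Rightarrow> real mat \<Rightarrow> (real mat \<times> real mat) set" where
  "Sigma_is N p U Xm Xp =
     {(A, B). A \<in> carrier_mat N N \<and> B \<in> carrier_mat N p \<and> Xp = A * Xm + B * U}"

definition Sigma_fb ::
  "time_domain \<Rightarrow> nat \<Rightarrow> nat \<Rightarrow> real mat \<Rightarrow> (real mat \<times> real mat) set" where
  "Sigma_fb td N p K =
     {(A, B). A \<in> carrier_mat N N \<and> B \<in> carrier_mat N p \<and> stable td (A + B * K)}"

definition informative_for_stabilization ::
  "time_domain \<Rightarrow> nat \<Rightarrow> nat \<Rightarrow> real mat \<Rightarrow> real mat \<Rightarrow> real mat \<Rightarrow> bool" where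
  "informative_for_stabilization td N p U Xm Xp \<longleftrightarrow>
     (\<exists>K\<in>carrier_mat p N. Sigma_is N p U Xm Xp \<subseteq> Sigma_fb td N p K)"

(* Vp is a basis matrix of the orthogonal complement of the column span of V; the set does
   not depend on its choice, since another choice changes the matrix in the stability
   condition by a similarity. *)
definition Sigma_is_s ::
  "time_domain \<Rightarrow> nat \<Rightarrow> nat \<Rightarrow> nat \<Rightarrow> real vec set \<Rightarrow> real mat \<Rightarrow> real mat \<Rightarrow> real mat \<Rightarrow>
   real mat \<Rightarrow> real mat \<Rightarrow> (real mat \<times> real mat) set" where
  "Sigma_is_s td N p n X0 U Xm Xp V Vp =
     {(A, B) \<in> Sigma_is N p U Xm Xp.
        low_dimensional td N p n X0 V A B \<and> stable td (mp_inverse Vp * A * Vp)}"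

end

theory Submission
  imports Defs
begin

text \<open>Write \<open>Q\<close> for the Moore-Penrose inverse of \<open>Vp\<close> and choose \<open>L\<close> with
  \<open>L V = 1\<close> and \<open>V L + Vp Q = 1\<close>. Low-dimensionality forces \<open>Q B = 0\<close> and \<open>Q X0 = 0\<close>.

  If \<open>Kh\<close> stabilizes all reduced models, then \<open>Xhm\<close> has full row rank: for \<open>\<xi>\<close> in its left
  kernel the data do not determine the state matrix up to rank-one terms \<open>w \<xi>\<^sup>T\<close>, and \<open>w\<close> can be
  chosen so that \<open>\<xi>\<close> becomes a fixed vector of the closed loop. As the data give
  \<open>Q A V Xhm = 0\<close>, every admissible \<open>A\<close> is block triangular, with diagonal blocks a reduced model
  and the stable matrix \<open>Q A Vp\<close>. The same structure survives the feedback \<open>Kh Vd\<close>.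

  Conversely, a reduced model \<open>(Ah, Bh)\<close> lifts to the admissible model
  \<open>(V Ah L + c Vp Q, V Bh)\<close> with \<open>c = 0\<close> or \<open>c = - 1\<close>, so that \<open>K V\<close> stabilizes \<open>(Ah, Bh)\<close>
  whenever \<open>K\<close> stabilizes the lift.\<close>

section \<open>Elementary identities for matrices, vectors and complexification\<close>

lemma mult_mat_zero_vec: "(M :: 'a :: semiring_0 mat) \<in> carrier_mat r c \<Longrightarrow> M *\<^sub>v 0\<^sub>v c = 0\<^sub>v r"
  by (intro eq_vecI) auto

lemma zero_mult_mat_vec: "(v :: 'a :: semiring_0 vec) \<in> carrier_vec c \<Longrightarrow> 0\<^sub>m r c *\<^sub>v v = 0\<^sub>v r"
  by (intro eq_vecI) (auto simp: scalar_prod_def)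

lemma map_mat_zero: "map_mat complex_of_real (0\<^sub>m r c) = 0\<^sub>m r c"
  by (intro eq_matI) auto

lemma map_mat_complex_of_real_add:
  "A \<in> carrier_mat r c \<Longrightarrow> B \<in> carrier_mat r c \<Longrightarrow>
    map_mat complex_of_real (A + B) = map_mat complex_of_real A + map_mat complex_of_real B"
  by (intro eq_matI) auto

lemma map_mat_complex_of_real_mult:
  "A \<in> carrier_mat r k \<Longrightarrow> B \<in> carrier_mat k c \<Longrightarrow>
    map_mat complex_of_real (A * B) = map_mat complex_of_real A * map_mat complex_of_real B"
  by (rule of_real_hom.mat_hom_mult)

lemma mult_mat_unit_vec:
  "(M :: 'a :: semiring_1 mat) \<in> carrier_mat r c \<Longrightarrow> j < c \<Longrightarrow> M *\<^sub>v unit_vec c j = col M j"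
  by (intro eq_vecI) auto

lemma smult_mat_mult_vec:
  "(M :: 'a :: comm_semiring_0 mat) \<in> carrier_mat r c \<Longrightarrow> v \<in> carrier_vec c \<Longrightarrow> (a \<cdot>\<^sub>m M) *\<^sub>v v = a \<cdot>\<^sub>v (M *\<^sub>v v)"
  by (intro eq_vecI) auto

section \<open>Eigenvalues of block triangular matrices\<close>

lemma eigenvalueI:
  assumes "M \<in> carrier_mat n n" "v \<in> carrier_vec n" "v \<noteq> 0\<^sub>v n" "M *\<^sub>v v = k \<cdot>\<^sub>v v"
  shows "eigenvalue M k"
  using assms unfolding eigenvalue_def eigenvector_def by auto

lemma eigenvalueE:
  assumes "eigenvalue M k" "M \<in> carrier_mat n n"
  obtains v where "v \<in> carrier_vec n" "v \<noteq> 0\<^sub>v n" "M *\<^sub>v v = k \<cdot>\<^sub>v v"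
  using assms unfolding eigenvalue_def eigenvector_def by auto

text \<open>Encodes a direct sum of the ranges of \<open>V\<close> and \<open>W\<close>, with
  \<open>L\<close> and \<open>Q\<close> reading off the two coordinates. The remaining identity
  \<open>L * W = 0\<close> follows on multiplying \<open>split\<close> by \<open>L\<close> from the
  left and by \<open>W\<close> from the right. The field is arbitrary so that the same facts apply
  to real matrices and to their complexifications.\<close>

locale splitting =
  fixes N n m :: nat and V L W Q :: "'a :: field mat"
  assumes V [simp]: "V \<in> carrier_mat N n" and L [simp]: "L \<in> carrier_mat n N"
    and W [simp]: "W \<in> carrier_mat N m" and Q [simp]: "Q \<in> carrier_mat m N"
    and LV: "L * V = 1\<^sub>m n" and QV: "Q * V = 0\<^sub>m m n" and QW: "Q * W = 1\<^sub>m m"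
    and split: "V * L + W * Q = 1\<^sub>m N"
begin

lemma LV_vec [simp]: "h \<in> carrier_vec n \<Longrightarrow> L *\<^sub>v (V *\<^sub>v h) = h"
  using assoc_mult_mat_vec[OF L V] by (simp add: LV)

lemma QV_vec [simp]: "h \<in> carrier_vec n \<Longrightarrow> Q *\<^sub>v (V *\<^sub>v h) = 0\<^sub>v m"
  using assoc_mult_mat_vec[OF Q V] by (simp add: QV zero_mult_mat_vec)

lemma split_vec:
  assumes x: "x \<in> carrier_vec N"
  shows "x = V *\<^sub>v (L *\<^sub>v x) + W *\<^sub>v (Q *\<^sub>v x)"
proof -
  have "x = (V * L + W * Q) *\<^sub>v x" using x by (simp add: split)
  also have "\<dots> = (V * L) *\<^sub>v x + (W * Q) *\<^sub>v x"
    using x by (intro add_mult_distrib_mat_vec[where nr = N and nc = N]) (auto intro: mult_carrier_mat[OF V L] mult_carrier_mat[OF W Q])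
  finally show ?thesis using x assoc_mult_mat_vec[OF V L x] assoc_mult_mat_vec[OF W Q x] by simp
qed

text \<open>When the \<open>Q\<close> coordinate vanishes, \<open>split_vec\<close> leaves only the
  \<open>V\<close> term. This turns the existence of reduced states, as in
  \<open>low_dimensional\<close>, into a linear equation.\<close>

lemma range_iff:
  assumes x: "x \<in> carrier_vec N"
  shows "(\<exists>h\<in>carrier_vec n. x = V *\<^sub>v h) \<longleftrightarrow> Q *\<^sub>v x = 0\<^sub>v m"
proof
  assume Qx: "Q *\<^sub>v x = 0\<^sub>v m"
  have "W *\<^sub>v 0\<^sub>v m = 0\<^sub>v N" using W by (rule mult_mat_zero_vec)
  then have "x = V *\<^sub>v (L *\<^sub>v x)"
    using split_vec[OF x] Qx x by (metis L V mult_mat_vec_carrier right_zero_vec)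
  then show "\<exists>h\<in>carrier_vec n. x = V *\<^sub>v h" using x L mult_mat_vec_carrier by blast
qed auto

lemma range_mat:
  assumes M: "M \<in> carrier_mat N k" and QM: "Q * M = 0\<^sub>m m k"
  shows "M = V * (L * M)"
proof -
  have "M = (V * L + W * Q) * M" using M by (simp add: split)
  also have "\<dots> = V * L * M + W * Q * M"
    using M mult_carrier_mat[OF V L] mult_carrier_mat[OF W Q] by (intro add_mult_distrib_mat)
  also have "W * Q * M = 0\<^sub>m N k"
    using assoc_mult_mat[OF W Q M] right_mult_zero_mat[OF W] by (simp add: QM)
  also have "V * L * M = V * (L * M)" by (rule assoc_mult_mat[OF V L M])
  finally show ?thesis
    using right_add_zero_mat[OF mult_carrier_mat[OF V mult_carrier_mat[OF L M]]] by simp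
qed

text \<open>The left inverse \<open>L\<close> makes \<open>V\<close> injective, so \<open>V\<close>
  carries an eigenvector of \<open>M1\<close> to an eigenvector of \<open>M\<close>.\<close>

lemma eigenvalue_compression:
  assumes M: "M \<in> carrier_mat N N" and M1: "M1 \<in> carrier_mat n n" and MV: "M * V = V * M1"
    and ev: "eigenvalue M1 k"
  shows "eigenvalue M k"
proof -
  obtain v where v: "v \<in> carrier_vec n" "v \<noteq> 0\<^sub>v n" "M1 *\<^sub>v v = k \<cdot>\<^sub>v v"
    by (rule eigenvalueE[OF ev M1])
  show ?thesis
  proof (rule eigenvalueI[OF M])
    show "V *\<^sub>v v \<in> carrier_vec N" using V v(1) by (rule mult_mat_vec_carrier)
    have "L *\<^sub>v 0\<^sub>v N = 0\<^sub>v n" using L by (rule mult_mat_zero_vec)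
    then show "V *\<^sub>v v \<noteq> 0\<^sub>v N" using v LV_vec by metis
    show "M *\<^sub>v (V *\<^sub>v v) = k \<cdot>\<^sub>v (V *\<^sub>v v)"
      using assoc_mult_mat_vec[OF M V v(1)] assoc_mult_mat_vec[OF V M1 v(1)] v mult_mat_vec[OF V v(1)]
      by (simp add: MV)
  qed
qed

text \<open>In the coordinates given by \<open>L\<close> and \<open>Q\<close>, the matrix
  \<open>M\<close> is block upper triangular with diagonal blocks \<open>M1\<close> and
  \<open>Q * M * W\<close>. If the \<open>Q\<close> coordinate of an eigenvector is nonzero, it is
  an eigenvector of the second block; otherwise the \<open>L\<close> coordinate is an eigenvector of
  the first.\<close>

lemma eigenvalue_block_triangular:
  assumes M: "M \<in> carrier_mat N N" and M1: "M1 \<in> carrier_mat n n" and MV: "M * V = V * M1"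
    and ev: "eigenvalue M k"
  shows "eigenvalue M1 k \<or> eigenvalue (Q * M * W) k"
proof -
  obtain w where w: "w \<in> carrier_vec N" "w \<noteq> 0\<^sub>v N" "M *\<^sub>v w = k \<cdot>\<^sub>v w"
    by (rule eigenvalueE[OF ev M])
  define y z where "y = Q *\<^sub>v w" and "z = L *\<^sub>v w"
  have y: "y \<in> carrier_vec m" unfolding y_def using Q w(1) by (rule mult_mat_vec_carrier)
  have z: "z \<in> carrier_vec n" unfolding z_def using L w(1) by (rule mult_mat_vec_carrier)
  have Mz: "M *\<^sub>v (V *\<^sub>v z) = V *\<^sub>v (M1 *\<^sub>v z)"
    using assoc_mult_mat_vec[OF M V z] assoc_mult_mat_vec[OF V M1 z] by (simp add: MV)
  have M1z: "M1 *\<^sub>v z \<in> carrier_vec n" using M1 z by (rule mult_mat_vec_carrier)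
  have VM1z: "V *\<^sub>v (M1 *\<^sub>v z) \<in> carrier_vec N" using V M1z by (rule mult_mat_vec_carrier)
  have Vz: "V *\<^sub>v z \<in> carrier_vec N" using V z by (rule mult_mat_vec_carrier)
  have Wy: "W *\<^sub>v y \<in> carrier_vec N" using W y by (rule mult_mat_vec_carrier)
  have MWy: "M *\<^sub>v (W *\<^sub>v y) \<in> carrier_vec N" using M Wy by (rule mult_mat_vec_carrier)
  have w_eq: "w = V *\<^sub>v z + W *\<^sub>v y" using split_vec[OF w(1)] by (simp add: y_def z_def)
  then have Mw: "M *\<^sub>v w = V *\<^sub>v (M1 *\<^sub>v z) + M *\<^sub>v (W *\<^sub>v y)"
    using mult_add_distrib_mat_vec[OF M Vz Wy] by (simp add: Mz)
  show ?thesis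
  proof (cases "y = 0\<^sub>v m")
    case True
    have "W *\<^sub>v 0\<^sub>v m = 0\<^sub>v N" using W by (rule mult_mat_zero_vec)
    then have wz: "w = V *\<^sub>v z" using w_eq True Vz by simp
    have "V *\<^sub>v 0\<^sub>v n = 0\<^sub>v N" using V by (rule mult_mat_zero_vec)
    then have "z \<noteq> 0\<^sub>v n" using wz w(2) by auto
    moreover have "M1 *\<^sub>v z = k \<cdot>\<^sub>v z"
    proof -
      have "V *\<^sub>v (M1 *\<^sub>v z) = V *\<^sub>v (k \<cdot>\<^sub>v z)"
        using Mz wz w(3) mult_mat_vec[OF V z] by simp
      then show ?thesis using M1z z by (metis LV_vec smult_carrier_vec)
    qed
    ultimately show ?thesis using eigenvalueI[OF M1 z] by blast
  next
    case False
    have QMW: "Q * M * W \<in> carrier_mat m m"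
      by (intro mult_carrier_mat[OF _ W] mult_carrier_mat[OF Q M])
    have "k \<cdot>\<^sub>v y = Q *\<^sub>v (M *\<^sub>v w)"
      using w mult_mat_vec[OF Q w(1)] by (simp add: y_def)
    also have "\<dots> = Q *\<^sub>v (M *\<^sub>v (W *\<^sub>v y))"
      using mult_add_distrib_mat_vec[OF Q VM1z MWy] M1z Q MWy by (simp add: Mw)
    also have "\<dots> = (Q * M * W) *\<^sub>v y"
      using assoc_mult_mat_vec[OF mult_carrier_mat[OF Q M] W y] assoc_mult_mat_vec[OF Q M Wy] by simp
    finally show ?thesis using eigenvalueI[OF QMW y False] by simp
  qed
qed

end

section \<open>Complexification and stability of real matrices\<close>

lemma splitting_of_real:
  assumes "splitting N n m V L W Q"
  shows "splitting N n m (map_mat complex_of_real V) (map_mat complex_of_real L)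
    (map_mat complex_of_real W) (map_mat complex_of_real Q)"
proof -
  interpret splitting N n m V L W Q by fact
  show ?thesis
  proof
    show "map_mat complex_of_real L * map_mat complex_of_real V = 1\<^sub>m n"
      using map_mat_complex_of_real_mult[OF L V] by (simp add: LV of_real_hom.mat_hom_one)
    show "map_mat complex_of_real Q * map_mat complex_of_real V = 0\<^sub>m m n"
      using map_mat_complex_of_real_mult[OF Q V] by (simp add: QV map_mat_zero)
    show "map_mat complex_of_real Q * map_mat complex_of_real W = 1\<^sub>m m"
      using map_mat_complex_of_real_mult[OF Q W] by (simp add: QW of_real_hom.mat_hom_one)
    show "map_mat complex_of_real V * map_mat complex_of_real L
        + map_mat complex_of_real W * map_mat complex_of_real Q = 1\<^sub>m N"
      using map_mat_complex_of_real_mult[OF V L] map_mat_complex_of_real_mult[OF W Q]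
        map_mat_complex_of_real_add[OF mult_carrier_mat[OF V L] mult_carrier_mat[OF W Q]]
      by (simp add: split of_real_hom.mat_hom_one)
  qed auto
qed

lemma stable_compression:
  assumes "splitting N n m V L W Q" "M \<in> carrier_mat N N" "M1 \<in> carrier_mat n n"
    "M * V = V * M1" "stable td M"
  shows "stable td M1"
proof -
  interpret splitting N n m V L W Q by fact
  interpret C: splitting N n m "map_mat complex_of_real V" "map_mat complex_of_real L"
    "map_mat complex_of_real W" "map_mat complex_of_real Q"
    by (rule splitting_of_real) fact
  have "map_mat complex_of_real M * map_mat complex_of_real V
      = map_mat complex_of_real V * map_mat complex_of_real M1"
    using map_mat_complex_of_real_mult[OF assms(2) V] map_mat_complex_of_real_mult[OF V assms(3)] assms(4)
    by simp
  then show ?thesis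
    using C.eigenvalue_compression[of "map_mat of_real M" "map_mat of_real M1"] assms(2,3,5)
    unfolding stable_def by simp
qed

lemma stable_block_triangular:
  assumes "splitting N n m V L W Q" "M \<in> carrier_mat N N" "M1 \<in> carrier_mat n n"
    "M * V = V * M1" "stable td M1" "stable td (Q * M * W)"
  shows "stable td M"
proof -
  interpret splitting N n m V L W Q by fact
  interpret C: splitting N n m "map_mat complex_of_real V" "map_mat complex_of_real L"
    "map_mat complex_of_real W" "map_mat complex_of_real Q"
    by (rule splitting_of_real) fact
  have "map_mat complex_of_real M * map_mat complex_of_real V
      = map_mat complex_of_real V * map_mat complex_of_real M1"
    using map_mat_complex_of_real_mult[OF assms(2) V] map_mat_complex_of_real_mult[OF V assms(3)] assms(4)
    by simp
  moreover have "map_mat complex_of_real (Q * M * W)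
      = map_mat complex_of_real Q * map_mat complex_of_real M * map_mat complex_of_real W"
    using map_mat_complex_of_real_mult[OF mult_carrier_mat[OF Q assms(2)] W]
      map_mat_complex_of_real_mult[OF Q assms(2)] by simp
  ultimately show ?thesis
    using C.eigenvalue_block_triangular[of "map_mat of_real M" "map_mat of_real M1"] assms(2,3,5,6)
    unfolding stable_def by fastforce
qed

text \<open>Supplies the stable complementary block of the lifted models.\<close>

lemma stable_smult_one:
  assumes "case td of Discrete \<Rightarrow> \<bar>c\<bar> < 1 | Continuous \<Rightarrow> c < 0"
  shows "stable td (c \<cdot>\<^sub>m 1\<^sub>m m)"
  unfolding stable_def
proof (intro allI impI)
  fix z assume ev: "eigenvalue (map_mat complex_of_real (c \<cdot>\<^sub>m 1\<^sub>m m)) z"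
  obtain v where v: "v \<in> carrier_vec m" "v \<noteq> 0\<^sub>v m"
      "map_mat complex_of_real (c \<cdot>\<^sub>m 1\<^sub>m m) *\<^sub>v v = z \<cdot>\<^sub>v v"
    by (rule eigenvalueE[OF ev, of m]) auto
  have "map_mat complex_of_real (c \<cdot>\<^sub>m 1\<^sub>m m) = of_real c \<cdot>\<^sub>m 1\<^sub>m m" by (intro eq_matI) auto
  then have e: "of_real c \<cdot>\<^sub>v v = z \<cdot>\<^sub>v v"
    using v(1,3) by (simp add: smult_mat_mult_vec[OF one_carrier_mat v(1)])
  obtain i where i: "i < m" "v $ i \<noteq> 0" using v(1,2) by (metis carrier_vecD eq_vecI index_zero_vec)
  have "of_real c * v $ i = z * v $ i" using arg_cong[OF e, of "\<lambda>w. w $ i"] i v(1) by simp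
  then have "z = of_real c" using i by simp
  then show "case td of Discrete \<Rightarrow> cmod z < 1 | Continuous \<Rightarrow> Re z < 0"
    using assms by (cases td) auto
qed

text \<open>The eigenvalue 1 lies outside the open unit disk and outside the open left half-plane,
  so a fixed vector refutes stability in both time domains at once.\<close>

lemma not_stable_fixed_vector:
  assumes M: "M \<in> carrier_mat n n" and v: "v \<in> carrier_vec n" "v \<noteq> 0\<^sub>v n" "M *\<^sub>v v = v"
  shows "\<not> stable td M"
proof -
  have "eigenvalue (map_mat complex_of_real M) 1"
  proof (rule eigenvalueI)
    show "map_vec complex_of_real v \<noteq> 0\<^sub>v n"
      using v(1,2) by (auto simp: vec_eq_iff)
    show "map_mat complex_of_real M *\<^sub>v map_vec complex_of_real v = 1 \<cdot>\<^sub>v map_vec complex_of_real v"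
      using of_real_hom.mult_mat_vec_hom[OF M v(1), where 'a = complex] v(3) by simp
  qed (use M v in auto)
  then show ?thesis unfolding stable_def by (cases td) force+
qed

section \<open>Moore-Penrose inverses and orthogonal complements\<close>

lemma scalar_prod_self_eq_0:
  fixes v :: "real vec"
  assumes "v \<in> carrier_vec n" "v \<bullet> v = 0"
  shows "v = 0\<^sub>v n"
proof -
  have "(\<Sum>i\<in>{0..<n}. v $ i * v $ i) = 0" using assms by (simp add: scalar_prod_def)
  then have "\<forall>i\<in>{0..<n}. v $ i * v $ i = 0" by (subst (asm) sum_nonneg_eq_0_iff) auto
  then show ?thesis using assms(1) by (intro eq_vecI) auto
qed

text \<open>The rank depends only on the set of columns, so deleting repetitions preserves it; a
  repetition would leave fewer columns than the rank. Distinctness has to be secured separately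
  because linear independence is a property of the set of columns.\<close>

lemma (in vec_space) distinct_cols_if_full_column_rank:
  assumes A: "A \<in> carrier_mat n nc" and rank: "rank A = nc"
  shows "distinct (cols A)"
proof -
  have "set (cols A) \<subseteq> carrier_vec n" using cols_dim A by blast
  then have "cols (mat_of_cols n (remdups (cols A))) = remdups (cols A)"
    by (intro cols_mat_of_cols) simp
  then have "rank (mat_of_cols n (remdups (cols A))) = rank A" by (simp add: rank_def)
  moreover have "rank (mat_of_cols n (remdups (cols A))) \<le> length (remdups (cols A))"
    by (rule rank_le_nc) simp
  ultimately have "length (remdups (cols A)) = length (cols A)"
    using A rank length_remdups_leq[of "cols A"] by simp
  then show ?thesis by (metis length_remdups_card_conv card_distinct)
qed

text \<open>If \<open>M\<^sup>T * M\<close> kills \<open>v\<close>, then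
  \<open>M *\<^sub>v v\<close> has norm zero and injectivity gives \<open>v = 0\<close>; hence the
  Gram matrix is invertible. Its inverse inherits its symmetry.\<close>

lemma transpose_mult_self_inverse:
  fixes M :: "real mat"
  assumes M: "M \<in> carrier_mat r c"
    and inj: "\<And>v. v \<in> carrier_vec c \<Longrightarrow> M *\<^sub>v v = 0\<^sub>v r \<Longrightarrow> v = 0\<^sub>v c"
  obtains G where "G \<in> carrier_mat c c" "G * (M\<^sup>T * M) = 1\<^sub>m c" "M\<^sup>T * M * G = 1\<^sub>m c" "G\<^sup>T = G"
proof -
  have MT: "M\<^sup>T \<in> carrier_mat c r" using M by simp
  have MM: "M\<^sup>T * M \<in> carrier_mat c c" using mult_carrier_mat[OF MT M] .
  have "det (M\<^sup>T * M) \<noteq> 0"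
  proof
    assume "det (M\<^sup>T * M) = 0"
    then obtain v where v: "v \<in> carrier_vec c" "v \<noteq> 0\<^sub>v c" "M\<^sup>T * M *\<^sub>v v = 0\<^sub>v c"
      using det_0_iff_vec_prod_zero[OF MM] by blast
    have Mv: "M *\<^sub>v v \<in> carrier_vec r" using M v(1) by (rule mult_mat_vec_carrier)
    have "(M *\<^sub>v v) \<bullet> (M *\<^sub>v v) = v \<bullet> (M\<^sup>T *\<^sub>v (M *\<^sub>v v))"
      using transpose_vec_mult_scalar[OF M v(1) Mv]
        comm_scalar_prod[OF v(1) mult_mat_vec_carrier[OF MT Mv]] by simp
    also have "\<dots> = 0" using v assoc_mult_mat_vec[OF MT M v(1)] by simp
    finally have "M *\<^sub>v v = 0\<^sub>v r" by (rule scalar_prod_self_eq_0[OF Mv])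
    then show False using inj v by blast
  qed
  then obtain G where G: "G \<in> carrier_mat c c" "M\<^sup>T * M * G = 1\<^sub>m c" "G * (M\<^sup>T * M) = 1\<^sub>m c"
    using det_non_zero_imp_unit[OF MM, of undefined] by (auto simp: Units_def ring_mat_def)
  have "(M\<^sup>T * M)\<^sup>T = M\<^sup>T * M" using transpose_mult[OF MT M] by simp
  then have "G\<^sup>T * (M\<^sup>T * M) = 1\<^sub>m c"
    using transpose_mult[OF MM G(1)] G(2) by simp
  moreover have GT: "G\<^sup>T \<in> carrier_mat c c" using G(1) by simp
  ultimately have "G\<^sup>T = G"
    using assoc_mult_mat[OF GT MM G(1)] left_mult_one_mat[OF G(1)] right_mult_one_mat[OF GT]
    unfolding G(2) by simp
  then show thesis using that G by blast
qed

text \<open>Replaces the definite description by the closed form of the pseudoinverse of an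
  injective matrix, \<open>G\<close> being the inverse of the Gram matrix.\<close>

lemma mp_inverse_eq:
  fixes M :: "real mat"
  assumes M: "M \<in> carrier_mat r c" and G: "G \<in> carrier_mat c c" "G * (M\<^sup>T * M) = 1\<^sub>m c" "G\<^sup>T = G"
  shows "mp_inverse M = G * M\<^sup>T"
proof -
  have MT: "M\<^sup>T \<in> carrier_mat c r" using M by simp
  have GM: "G * M\<^sup>T \<in> carrier_mat c r" using G(1) MT by (rule mult_carrier_mat)
  have left: "G * M\<^sup>T * M = 1\<^sub>m c" using G assoc_mult_mat[OF G(1) MT M] by simp
  have sym: "(M * (G * M\<^sup>T))\<^sup>T = M * (G * M\<^sup>T)"
    using transpose_mult[OF M GM] transpose_mult[OF G(1) MT] G(3) assoc_mult_mat[OF M G(1) MT] by simp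
  show ?thesis
    unfolding mp_inverse_def
  proof (rule the_equality)
    show "G * M\<^sup>T \<in> carrier_mat (dim_col M) (dim_row M) \<and>
      M * (G * M\<^sup>T) * M = M \<and> G * M\<^sup>T * M * (G * M\<^sup>T) = G * M\<^sup>T \<and>
      transpose_mat (M * (G * M\<^sup>T)) = M * (G * M\<^sup>T) \<and> transpose_mat (G * M\<^sup>T * M) = G * M\<^sup>T * M"
      using M GM left sym assoc_mult_mat[OF M GM M] left_mult_one_mat[OF GM] by simp
  next
    fix P assume "P \<in> carrier_mat (dim_col M) (dim_row M) \<and> M * P * M = M \<and> P * M * P = P \<and>
      transpose_mat (M * P) = M * P \<and> transpose_mat (P * M) = P * M"
    then have P: "P \<in> carrier_mat c r" "M * P * M = M" "(M * P)\<^sup>T = M * P" using M by auto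
    have MP: "M * P \<in> carrier_mat r r" using M P(1) by (rule mult_carrier_mat)
    \<comment> \<open>Symmetry of \<open>M * P\<close> and \<open>M * P * M = M\<close> give the
      normal equation for \<open>P\<close>; multiplying it by \<open>G\<close> from the left
      isolates \<open>P\<close>.\<close>
    have "M\<^sup>T * (M * P) = (M * P * M)\<^sup>T" using transpose_mult[OF MP M] P by simp
    then have "M\<^sup>T * (M * P) = M\<^sup>T" using P by simp
    then have "G * M\<^sup>T = G * (M\<^sup>T * (M * P))" by simp
    also have "\<dots> = G * M\<^sup>T * M * P"
      using assoc_mult_mat[OF G(1) MT MP] assoc_mult_mat[OF GM M P(1)] by simp
    finally show "P = G * M\<^sup>T" using left P(1) by simp
  qed
qed

text \<open>With \<open>L\<close> the pseudoinverse of \<open>V\<close>, the products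
  \<open>V * L\<close> and \<open>W * Q\<close> are the orthogonal projections onto the span of
  \<open>V\<close> and onto its complement, which add up to the identity.\<close>

lemma orthogonal_complement_splitting:
  fixes V W :: "real mat"
  assumes V: "V \<in> carrier_mat N n" and rk: "vec_space.rank N V = n"
    and bm: "basis_matrix N (vec_module.orthogonal_complement N (vec_space.col_space N V)) W"
  obtains L where "splitting N n (dim_col W) V L W (mp_inverse W)"
proof -
  interpret vec_space "TYPE(real)" N .
  define m where "m = dim_col W"
  have W: "W \<in> carrier_mat N m" and dW: "distinct (cols W)" and iW: "lin_indpt (set (cols W))"
    and sW: "col_space W = orthogonal_complement (col_space V)"
    using bm unfolding basis_matrix_def m_def by auto
  have VT: "V\<^sup>T \<in> carrier_mat n N" and WT: "W\<^sup>T \<in> carrier_mat m N" using V W by auto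
  have dV: "distinct (cols V)" using V rk by (rule distinct_cols_if_full_column_rank)
  have injV: "v = 0\<^sub>v n" if "v \<in> carrier_vec n" "V *\<^sub>v v = 0\<^sub>v N" for v
    using lin_depI[OF V that(1) _ that(2) dV] full_rank_lin_indpt[OF V rk dV] by metis
  have injW: "v = 0\<^sub>v m" if "v \<in> carrier_vec m" "W *\<^sub>v v = 0\<^sub>v N" for v
    using lin_depI[OF W that(1) _ that(2) dW] iW by metis
  obtain G where G: "G \<in> carrier_mat n n" "G * (V\<^sup>T * V) = 1\<^sub>m n" "V\<^sup>T * V * G = 1\<^sub>m n" "G\<^sup>T = G"
    by (rule transpose_mult_self_inverse[OF V injV])
  obtain H where H: "H \<in> carrier_mat m m" "H * (W\<^sup>T * W) = 1\<^sub>m m" "W\<^sup>T * W * H = 1\<^sub>m m" "H\<^sup>T = H"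
    by (rule transpose_mult_self_inverse[OF W injW])
  define L Q where "L = G * V\<^sup>T" and "Q = H * W\<^sup>T"
  have Q_eq: "mp_inverse W = Q" unfolding Q_def by (rule mp_inverse_eq[OF W H(1,2,4)])
  have L: "L \<in> carrier_mat n N" unfolding L_def using G(1) VT by (rule mult_carrier_mat)
  have Q: "Q \<in> carrier_mat m N" unfolding Q_def using H(1) WT by (rule mult_carrier_mat)
  have colV: "V *\<^sub>v x \<in> col_space V" if "x \<in> carrier_vec n" for x
    using col_space_eq[OF V] V that by auto
  have colW: "W *\<^sub>v y \<in> orthogonal_complement (col_space V)" if "y \<in> carrier_vec m" for y
    using col_space_eq[OF W] W that sW by auto
  have WV: "W\<^sup>T * V = 0\<^sub>m m n"
  proof (rule eq_matI)
    fix i j assume ij: "i < dim_row (0\<^sub>m m n :: real mat)" "j < dim_col (0\<^sub>m m n :: real mat)"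
    have "W *\<^sub>v unit_vec m i = col W i" "V *\<^sub>v unit_vec n j = col V j"
      using mult_mat_unit_vec[OF W] mult_mat_unit_vec[OF V] ij by auto
    then have "col W i \<bullet> col V j = 0"
      using colW[of "unit_vec m i"] colV[of "unit_vec n j"] ij
      unfolding orthogonal_complement_def by auto
    then show "(W\<^sup>T * V) $$ (i, j) = 0\<^sub>m m n $$ (i, j)" using ij V W by simp
  qed (use V W in auto)
  have VW: "V\<^sup>T * W = 0\<^sub>m n m" using arg_cong[OF WV, of transpose_mat] transpose_mult[OF WT V] by simp
  have LV: "L * V = 1\<^sub>m n" unfolding L_def using G assoc_mult_mat[OF G(1) VT V] by simp
  have QW: "Q * W = 1\<^sub>m m" unfolding Q_def using H assoc_mult_mat[OF H(1) WT W] by simp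
  have QV: "Q * V = 0\<^sub>m m n" unfolding Q_def
    using H assoc_mult_mat[OF H(1) WT V] right_mult_zero_mat[OF H(1)] by (simp add: WV)
  have VL: "V * L \<in> carrier_mat N N" using V L by (rule mult_carrier_mat)
  have WQ: "W * Q \<in> carrier_mat N N" using W Q by (rule mult_carrier_mat)
  \<comment> \<open>\<open>E\<close> is the defect of the decomposition. Its values are orthogonal
    to the span of \<open>V\<close>, hence lie in the span of \<open>W\<close>; being orthogonal to
    that as well, they vanish.\<close>
  define E where "E = 1\<^sub>m N - (V * L + W * Q)"
  have S: "V * L + W * Q \<in> carrier_mat N N" using WQ by (rule add_carrier_mat)
  have E: "E \<in> carrier_mat N N" unfolding E_def using S by (rule minus_carrier_mat)
  have "V\<^sup>T * (V * L + W * Q) = V\<^sup>T * (V * L) + V\<^sup>T * (W * Q)"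
    by (rule mult_add_distrib_mat[OF VT VL WQ])
  also have "V\<^sup>T * (V * L) = V\<^sup>T * V * G * V\<^sup>T"
    unfolding L_def using assoc_mult_mat[OF VT V L, unfolded L_def]
      assoc_mult_mat[OF mult_carrier_mat[OF VT V] G(1) VT] by simp
  also have "V\<^sup>T * (W * Q) = 0\<^sub>m n N" using assoc_mult_mat[OF VT W Q] Q by (simp add: VW)
  finally have "V\<^sup>T * (V * L + W * Q) = V\<^sup>T" using G(3) VT by simp
  then have VE: "V\<^sup>T * E = 0\<^sub>m n N"
    unfolding E_def using mult_minus_distrib_mat[OF VT one_carrier_mat S] VT by simp
  have "W\<^sup>T * (V * L + W * Q) = W\<^sup>T * (V * L) + W\<^sup>T * (W * Q)"
    by (rule mult_add_distrib_mat[OF WT VL WQ])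
  also have "W\<^sup>T * (W * Q) = W\<^sup>T * W * H * W\<^sup>T"
    unfolding Q_def using assoc_mult_mat[OF WT W Q, unfolded Q_def]
      assoc_mult_mat[OF mult_carrier_mat[OF WT W] H(1) WT] by simp
  also have "W\<^sup>T * (V * L) = 0\<^sub>m m N" using assoc_mult_mat[OF WT V L] L by (simp add: WV)
  finally have "W\<^sup>T * (V * L + W * Q) = W\<^sup>T" using H(3) WT by simp
  then have WE: "W\<^sup>T * E = 0\<^sub>m m N"
    unfolding E_def using mult_minus_distrib_mat[OF WT one_carrier_mat S] WT by simp
  have E0: "E *\<^sub>v x = 0\<^sub>v N" if x: "x \<in> carrier_vec N" for x
  proof -
    have Ex: "E *\<^sub>v x \<in> carrier_vec N" using E x by (rule mult_mat_vec_carrier)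
    have VEx: "V\<^sup>T *\<^sub>v (E *\<^sub>v x) = 0\<^sub>v n" using assoc_mult_mat_vec[OF VT E x] x by (simp add: VE zero_mult_mat_vec)
    have "(E *\<^sub>v x) \<bullet> y = 0" if y: "y \<in> col_space V" for y
    proof -
      obtain h where h: "h \<in> carrier_vec n" "y = V *\<^sub>v h"
        using y V unfolding col_space_eq[OF V] by auto
      then show ?thesis
        using transpose_vec_mult_scalar[OF V h(1) Ex] VEx by (simp add: zero_mult_mat_vec)
    qed
    then have "E *\<^sub>v x \<in> col_space W" using Ex unfolding sW orthogonal_complement_def by blast
    then obtain z where z: "z \<in> carrier_vec m" "E *\<^sub>v x = W *\<^sub>v z"
      using W unfolding col_space_eq[OF W] by auto
    have "W\<^sup>T *\<^sub>v (E *\<^sub>v x) = 0\<^sub>v m" using assoc_mult_mat_vec[OF WT E x] x by (simp add: WE zero_mult_mat_vec)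
    then have "W\<^sup>T * W *\<^sub>v z = 0\<^sub>v m" using assoc_mult_mat_vec[OF WT W z(1)] z(2) by simp
    then have "H * (W\<^sup>T * W) *\<^sub>v z = H *\<^sub>v 0\<^sub>v m"
      using assoc_mult_mat_vec[OF H(1) mult_carrier_mat[OF WT W] z(1)] by simp
    then have "z = 0\<^sub>v m" using H z(1) by (auto intro!: eq_vecI)
    then show ?thesis using z(2) W by (auto intro!: eq_vecI)
  qed
  have "E = 0\<^sub>m N N"
  proof (rule eq_matI)
    fix i j assume "i < dim_row (0\<^sub>m N N :: real mat)" "j < dim_col (0\<^sub>m N N :: real mat)"
    then show "E $$ (i, j) = 0\<^sub>m N N $$ (i, j)"
      using arg_cong[OF E0[of "unit_vec N j"], of "\<lambda>v. v $ i"] E mult_mat_unit_vec[OF E, of j] by simp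
  qed (use E in auto)
  have split: "V * L + W * Q = 1\<^sub>m N"
  proof (intro eq_matI)
    fix i j assume ij: "i < dim_row (1\<^sub>m N :: real mat)" "j < dim_col (1\<^sub>m N :: real mat)"
    then have "(1\<^sub>m N :: real mat) $$ (i, j) - (V * L + W * Q) $$ (i, j) = E $$ (i, j)"
      unfolding E_def using S by (subst index_minus_mat(1)) auto
    then show "(V * L + W * Q) $$ (i, j) = 1\<^sub>m N $$ (i, j)" using \<open>E = 0\<^sub>m N N\<close> ij by simp
  qed (use S in auto)
  show thesis
    by (rule that[of L], unfold Q_eq m_def[symmetric], unfold_locales)
      (use V L W Q LV QV QW split in auto)
qed

section \<open>Velocities of curves and affine differential equations\<close>

lemma mult_mat_vec_index_sum:
  "M \<in> carrier_mat r c \<Longrightarrow> v \<in> carrier_vec c \<Longrightarrow> i < r \<Longrightarrow> (M *\<^sub>v v) $ i = (\<Sum>j<c. M $$ (i, j) * v $ j)"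
  by (auto simp: scalar_prod_def atLeast0LessThan intro!: sum.cong)

lemma has_velocity_mult_mat:
  assumes Q: "Q \<in> carrier_mat m N" and v: "has_velocity N x v t" and t: "t \<ge> 0"
    and x: "\<And>s. s \<ge> 0 \<Longrightarrow> x s \<in> carrier_vec N"
  shows "has_velocity m (\<lambda>s. Q *\<^sub>v x s) (Q *\<^sub>v v) t"
  unfolding has_velocity_def
proof (intro conjI allI impI)
  have vc: "v \<in> carrier_vec N" using v unfolding has_velocity_def by simp
  then show "Q *\<^sub>v v \<in> carrier_vec m" using Q by (rule mult_mat_vec_carrier[rotated])
  fix i assume i: "i < m"
  have "((\<lambda>s. \<Sum>j<N. Q $$ (i, j) * x s $ j) has_real_derivative (\<Sum>j<N. Q $$ (i, j) * v $ j)) (at t within {0..})"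
    using v unfolding has_velocity_def by (intro DERIV_sum DERIV_cmult) auto
  then have "((\<lambda>s. (Q *\<^sub>v x s) $ i) has_real_derivative (\<Sum>j<N. Q $$ (i, j) * v $ j)) (at t within {0..})"
    by (rule has_field_derivative_transform_within[where d = 1])
      (use t x mult_mat_vec_index_sum[OF Q _ i] in auto)
  then show "((\<lambda>s. (Q *\<^sub>v x s) $ i) has_real_derivative (Q *\<^sub>v v) $ i) (at t within {0..})"
    using mult_mat_vec_index_sum[OF Q vc i] by simp
qed

text \<open>At time 0 only a one-sided derivative is available; passing to the limit from the right
  treats this endpoint and the interior times alike.\<close>

lemma derivative_at_within_half_line_unique:
  fixes t :: real
  assumes "t \<ge> 0" "(f has_real_derivative a) (at t within {0..})" "(f has_real_derivative b) (at t within {0..})"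
  shows "a = b"
proof -
  have "{t<..} \<subseteq> {0..}" using assms(1) by auto
  then have "(f has_real_derivative a) (at_right t)" "(f has_real_derivative b) (at_right t)"
    using assms(2,3) DERIV_subset by blast+
  then show ?thesis
    unfolding has_field_derivative_iff using tendsto_unique[OF trivial_limit_at_right_real] by blast
qed

lemma has_velocity_unique:
  assumes "has_velocity N x v t" "has_velocity N x w t" "t \<ge> 0"
  shows "v = w"
  using assms derivative_at_within_half_line_unique
  unfolding has_velocity_def by (intro eq_vecI) auto

text \<open>The solution is \<open>x0 + (\<Sum>k. t ^ Suc k / fact (Suc k) * A ^ k * d)\<close> with
  \<open>d = A * x0 + b\<close>.\<close>

lemma affine_ode_solution:
  assumes A: "A \<in> carrier_mat N N" and b: "b \<in> carrier_vec N" and x0: "x0 \<in> carrier_vec N"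
  obtains x where "x 0 = x0" "\<And>t. x t \<in> carrier_vec N" "\<And>t. has_velocity N x (A *\<^sub>v x t + b) t"
proof -
  define d where "d = A *\<^sub>v x0 + b"
  have d: "d \<in> carrier_vec N" unfolding d_def using mult_mat_vec_carrier[OF A x0] b by simp
  define e where "e k = ((\<lambda>v. A *\<^sub>v v) ^^ k) d" for k
  have e: "e k \<in> carrier_vec N" for k
    unfolding e_def by (induction k) (use d mult_mat_vec_carrier[OF A] in auto)
  have e_Suc: "e (Suc k) $ i = (\<Sum>j<N. A $$ (i, j) * e k $ j)" if "i < N" for i k
    using mult_mat_vec_index_sum[OF A e that] by (simp add: e_def)
  \<comment> \<open>\<open>C\<close> dominates every absolute row sum of \<open>A\<close>, so each
    application of \<open>A\<close> multiplies a uniform bound on the entries by at most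
    \<open>C\<close>.\<close>
  define C where "C = (\<Sum>i<N. \<Sum>j<N. \<bar>A $$ (i, j)\<bar>)"
  define D where "D = (\<Sum>i<N. \<bar>d $ i\<bar>)"
  have C: "C \<ge> 0" and D: "D \<ge> 0" unfolding C_def D_def by (auto intro!: sum_nonneg)
  have bound: "\<bar>e k $ i\<bar> \<le> D * C ^ k" if "i < N" for k i
    using that
  proof (induction k arbitrary: i)
    case 0
    then show ?case using member_le_sum[of i "{..<N}" "\<lambda>i. \<bar>d $ i\<bar>"] by (simp add: e_def D_def)
  next
    case (Suc k)
    have "\<bar>e (Suc k) $ i\<bar> \<le> (\<Sum>j<N. \<bar>A $$ (i, j)\<bar> * \<bar>e k $ j\<bar>)"
      using sum_abs[of "\<lambda>j. A $$ (i, j) * e k $ j" "{..<N}"] by (simp add: e_Suc[OF Suc.prems] abs_mult)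
    also have "\<dots> \<le> (\<Sum>j<N. \<bar>A $$ (i, j)\<bar> * (D * C ^ k))"
      by (intro sum_mono mult_left_mono) (use Suc.IH in auto)
    also have "\<dots> = (\<Sum>j<N. \<bar>A $$ (i, j)\<bar>) * (D * C ^ k)" by (simp add: sum_distrib_right)
    also have "(\<Sum>j<N. \<bar>A $$ (i, j)\<bar>) \<le> C"
      unfolding C_def using Suc.prems
      by (intro member_le_sum[of i "{..<N}" "\<lambda>i. \<Sum>j<N. \<bar>A $$ (i, j)\<bar>"]) (auto intro!: sum_nonneg)
    then have "(\<Sum>j<N. \<bar>A $$ (i, j)\<bar>) * (D * C ^ k) \<le> C * (D * C ^ k)"
      using C D by (intro mult_right_mono) auto
    finally show ?case by (simp add: mult_ac)
  qed
  \<comment> \<open>Coefficients of the power series of entry \<open>i\<close>. The shift puts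
    \<open>e l\<close> in degree \<open>Suc l\<close>; the constant coefficient is zero because
    \<open>x0\<close> is kept apart in \<open>x\<close>.\<close>
  define c where "c i k = (case k of 0 \<Rightarrow> 0 | Suc l \<Rightarrow> e l $ i / fact k)" for i k
  have diffs_c: "diffs (c i) k = e k $ i / fact k" for i k
    by (simp add: diffs_def c_def field_simps del: of_nat_Suc)
  have summable: "summable (\<lambda>k. c i k * y ^ k)" if i: "i < N" for i and y :: real
  proof -
    have "summable (\<lambda>k. D * \<bar>y\<bar> * (inverse (fact k) * (C * \<bar>y\<bar>) ^ k))"
      by (intro summable_mult summable_exp)
    moreover have "norm (c i (Suc k) * y ^ Suc k) \<le> D * \<bar>y\<bar> * (inverse (fact k) * (C * \<bar>y\<bar>) ^ k)" for k
    proof -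
      have "norm (c i (Suc k) * y ^ Suc k) = \<bar>e k $ i\<bar> * (\<bar>y\<bar> ^ Suc k / fact (Suc k))"
        by (simp add: c_def abs_mult power_abs)
      also have "\<dots> \<le> (D * C ^ k) * (\<bar>y\<bar> ^ Suc k / fact k)"
        using bound[OF i, of k] C D fact_mono[of k "Suc k", where 'a = real]
        by (intro mult_mono frac_le) (auto simp del: fact_Suc)
      also have "\<dots> = D * \<bar>y\<bar> * (inverse (fact k) * (C * \<bar>y\<bar>) ^ k)"
        by (simp add: field_simps power_mult_distrib)
      finally show ?thesis .
    qed
    ultimately have "summable (\<lambda>k. c i (Suc k) * y ^ Suc k)"
      by (rule summable_comparison_test')
    then show ?thesis by (subst (asm) summable_Suc_iff)
  qed
  define x where "x t = vec N (\<lambda>i. x0 $ i + (\<Sum>k. c i k * t ^ k))" for t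
  have x: "x t \<in> carrier_vec N" for t by (simp add: x_def)
  have "x 0 = x0"
  proof (rule eq_vecI)
    fix i assume "i < dim_vec x0"
    moreover have "(\<Sum>k. c i k * 0 ^ k) = 0"
      by (subst powser_zero) (simp add: c_def)
    ultimately show "x 0 $ i = x0 $ i" using x0 by (simp add: x_def)
  qed (use x0 x_def in auto)
  moreover have "has_velocity N x (A *\<^sub>v x t + b) t" for t
    unfolding has_velocity_def
  proof (intro conjI allI impI)
    have Ax: "A *\<^sub>v x t \<in> carrier_vec N" using A x by (rule mult_mat_vec_carrier)
    then show "A *\<^sub>v x t + b \<in> carrier_vec N" using b by simp
    fix i assume i: "i < N"
    \<comment> \<open>The differentiated series is \<open>d\<close> plus \<open>A\<close> applied to
      the series without \<open>x0\<close>. The \<open>if\<close> places \<open>d\<close> in degree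
      0, and \<open>d = A *\<^sub>v x0 + b\<close> restores the missing part.\<close>
    have "(\<lambda>k. (if k = 0 then d $ i else 0) + (\<Sum>j<N. A $$ (i, j) * (c j k * t ^ k))) sums
        (d $ i + (\<Sum>j<N. A $$ (i, j) * (\<Sum>k. c j k * t ^ k)))"
      using sums_single[of 0 "\<lambda>_. d $ i"] summable
      by (intro sums_add sums_sum sums_mult summable_sums) auto
    moreover have "(if k = 0 then d $ i else 0) + (\<Sum>j<N. A $$ (i, j) * (c j k * t ^ k))
        = diffs (c i) k * t ^ k" for k
    proof (cases k)
      case 0
      then show ?thesis by (simp add: diffs_c c_def e_def)
    next
      case (Suc l)
      then show ?thesis
        unfolding diffs_c using e_Suc[OF i, of l]
        by (simp add: c_def sum_distrib_right sum_divide_distrib mult.assoc del: fact_Suc)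
    qed
    ultimately have "(\<Sum>k. diffs (c i) k * t ^ k) = d $ i + (\<Sum>j<N. A $$ (i, j) * (\<Sum>k. c j k * t ^ k))"
      using sums_unique by fastforce
    also have "\<dots> = (A *\<^sub>v x t + b) $ i"
      using i b Ax mult_mat_vec_index_sum[OF A x i, of t] mult_mat_vec_index_sum[OF A x0 i]
      by (simp add: d_def x_def distrib_left sum.distrib)
    finally have deriv: "(\<Sum>k. diffs (c i) k * t ^ k) = (A *\<^sub>v x t + b) $ i" .
    have "((\<lambda>s. x0 $ i + (\<Sum>k. c i k * s ^ k)) has_real_derivative 0 + (\<Sum>k. diffs (c i) k * t ^ k)) (at t)"
      by (intro DERIV_add DERIV_const termdiffs_strong_converges_everywhere summable[OF i])
    then show "((\<lambda>s. x s $ i) has_real_derivative (A *\<^sub>v x t + b) $ i) (at t within {0..})"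
      using i by (simp add: deriv x_def has_field_derivative_at_within)
  qed
  ultimately show thesis using that x by blast
qed

section \<open>Low-dimensionality expressed through \<open>Q\<close>\<close>

lemma linear_subspaceD:
  assumes "linear_subspace N X0"
  shows "X0 \<subseteq> carrier_vec N" "0\<^sub>v N \<in> X0"
  using assms unfolding linear_subspace_def VectorSpace.subspace_def submodule_def
  by (auto simp: module_vec_def)

text \<open>A constant input produces a trajectory from \<open>x0\<close> along which
  \<open>Q\<close> vanishes. The vector \<open>A *\<^sub>v x0 + B *\<^sub>v u\<close> is its state
  at time 1 in discrete time. In continuous time it is its initial velocity, and its image under
  \<open>Q\<close> is the derivative of a zero curve.\<close>

lemma low_dimensionalD:
  assumes sp: "splitting N n m V L W Q" and A: "A \<in> carrier_mat N N" and B: "B \<in> carrier_mat N p"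
    and low: "low_dimensional td N p n X0 V A B"
    and x0: "x0 \<in> X0" "x0 \<in> carrier_vec N" and u: "u \<in> carrier_vec p"
  shows "Q *\<^sub>v x0 = 0\<^sub>v m" "Q *\<^sub>v (A *\<^sub>v x0 + B *\<^sub>v u) = 0\<^sub>v m"
proof -
  interpret splitting N n m V L W Q by fact
  have Bu: "B *\<^sub>v u \<in> carrier_vec N" using B u by (rule mult_mat_vec_carrier)
  have "Q *\<^sub>v x0 = 0\<^sub>v m \<and> Q *\<^sub>v (A *\<^sub>v x0 + B *\<^sub>v u) = 0\<^sub>v m"
  proof (cases td)
    case Discrete
    define x where "x = rec_nat x0 (\<lambda>_ y. A *\<^sub>v y + B *\<^sub>v u)"
    have x_carrier: "x t \<in> carrier_vec N" for t
      by (induction t) (use x0 Bu mult_mat_vec_carrier[OF A] in \<open>auto simp: x_def\<close>)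
    have "trajectory_dt N p A B (\<lambda>_. u) x"
      unfolding trajectory_dt_def using u x_carrier by (auto simp: x_def)
    moreover have "x 0 = x0" by (simp add: x_def)
    ultimately obtain xh where xh: "\<And>t. xh t \<in> carrier_vec n \<and> x t = V *\<^sub>v xh t"
      using low x0(1) unfolding low_dimensional_def Discrete by fastforce
    have Qx: "Q *\<^sub>v x t = 0\<^sub>v m" for t using xh[of t] by simp
    show ?thesis using Qx[of 0] Qx[of 1] by (simp add: x_def)
  next
    case Continuous
    obtain x where x: "x 0 = x0" "\<And>t. x t \<in> carrier_vec N"
        "\<And>t. has_velocity N x (A *\<^sub>v x t + B *\<^sub>v u) t"
      using affine_ode_solution[OF A Bu x0(2)] by blast
    have "trajectory_ct N p A B (\<lambda>_. u) x"
      unfolding trajectory_ct_def using u x by auto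
    then obtain xh where xh: "\<And>t. t \<ge> 0 \<Longrightarrow> xh t \<in> carrier_vec n \<and> x t = V *\<^sub>v xh t"
      using low x0(1) x(1) unfolding low_dimensional_def Continuous by fastforce
    have Qx: "Q *\<^sub>v x t = 0\<^sub>v m" if "t \<ge> 0" for t using xh[OF that] by simp
    have vel: "has_velocity m (\<lambda>s. Q *\<^sub>v x s) (Q *\<^sub>v (A *\<^sub>v x0 + B *\<^sub>v u)) 0"
      using has_velocity_mult_mat[OF Q x(3)[of 0]] x by simp
    have "has_velocity m (\<lambda>s. Q *\<^sub>v x s) (0\<^sub>v m) 0"
      unfolding has_velocity_def
    proof (intro conjI allI impI)
      fix i assume i: "i < m"
      show "((\<lambda>s. (Q *\<^sub>v x s) $ i) has_real_derivative 0\<^sub>v m $ i) (at 0 within {0..})"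
        by (rule has_field_derivative_transform_within[of "\<lambda>_. 0", where d = 1]) (use i Qx in auto)
    qed simp
    then show ?thesis using has_velocity_unique[OF vel] Qx[of 0] x(1) by simp
  qed
  then show "Q *\<^sub>v x0 = 0\<^sub>v m" "Q *\<^sub>v (A *\<^sub>v x0 + B *\<^sub>v u) = 0\<^sub>v m" by auto
qed

lemma eq_zero_mat_if_mult_vec_zero:
  fixes M :: "'a :: semiring_1 mat"
  assumes M: "M \<in> carrier_mat r c" and "\<And>v. v \<in> carrier_vec c \<Longrightarrow> M *\<^sub>v v = 0\<^sub>v r"
  shows "M = 0\<^sub>m r c"
proof (rule eq_matI)
  fix i j assume ij: "i < dim_row (0\<^sub>m r c :: 'a mat)" "j < dim_col (0\<^sub>m r c :: 'a mat)"
  then show "M $$ (i, j) = 0\<^sub>m r c $$ (i, j)"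
    using arg_cong[OF assms(2)[of "unit_vec c j"], of "\<lambda>v. v $ i"] M mult_mat_unit_vec[OF M, of j] by simp
qed (use M in auto)

text \<open>The subspace \<open>X0\<close> contains zero, and from there the next state or the
  initial velocity is \<open>B *\<^sub>v u\<close>.\<close>

lemma low_dimensional_input_range:
  assumes sp: "splitting N n m V L W Q" and A: "A \<in> carrier_mat N N" and B: "B \<in> carrier_mat N p"
    and low: "low_dimensional td N p n X0 V A B" and X0: "linear_subspace N X0"
  shows "Q * B = 0\<^sub>m m p"
proof -
  interpret splitting N n m V L W Q by fact
  show ?thesis
  proof (rule eq_zero_mat_if_mult_vec_zero)
    show "Q * B \<in> carrier_mat m p" using Q B by (rule mult_carrier_mat)
    fix u :: "real vec" assume u: "u \<in> carrier_vec p"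
    have "Q *\<^sub>v (A *\<^sub>v 0\<^sub>v N + B *\<^sub>v u) = 0\<^sub>v m"
      using linear_subspaceD[OF X0] u by (intro low_dimensionalD(2)[OF sp A B low]) auto
    then show "Q * B *\<^sub>v u = 0\<^sub>v m"
      using assoc_mult_mat_vec[OF Q B u] mult_mat_vec_carrier[OF B u] by (simp add: mult_mat_zero_vec[OF A])
  qed
qed

text \<open>The integrating factor \<open>exp (- c * s)\<close> turns \<open>g\<close> into a
  function with zero derivative.\<close>

lemma scalar_linear_ode_zero:
  fixes g :: "real \<Rightarrow> real"
  assumes g: "\<And>t. t \<ge> 0 \<Longrightarrow> (g has_real_derivative c * g t) (at t within {0..})"
    and "g 0 = 0" and t: "t \<ge> 0"
  shows "g t = 0"
proof (cases "t = 0")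
  case False
  define h where "h s = g s * exp (- c * s)" for s
  have h: "(h has_real_derivative 0) (at s within {0..})" if "s \<ge> 0" for s
    unfolding h_def using g[OF that] by (auto intro!: derivative_eq_intros)
  have "continuous_on {0..t} h"
    unfolding continuous_on_eq_continuous_within
    using h by (metis DERIV_continuous DERIV_subset Icc_subset_Ici_iff atLeastAtMost_iff order_refl)
  \<comment> \<open>At interior times the derivative within the half-line becomes two-sided by
    restriction to an open half-line.\<close>
  moreover have "DERIV h s :> 0" if "0 < s" "s < t" for s
  proof -
    have "(h has_real_derivative 0) (at s within {0<..})"
      by (rule DERIV_subset[OF h]) (use that in auto)
    then show ?thesis using that at_within_open[of s "{0<..}"] by simp
  qed
  ultimately have "h t = h 0" using t False by (intro DERIV_isconst2[of 0 t]) auto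
  then show ?thesis using assms(2) by (simp add: h_def)
qed (use assms in simp)

text \<open>By \<open>QA\<close> and \<open>QB\<close> the coordinate \<open>Q *\<^sub>v x t\<close>
  evolves on its own, with the scalar coefficient \<open>c\<close> and free of the input. It starts
  at zero and therefore stays there, whatever the input is.\<close>

lemma low_dimensionalI:
  assumes sp: "splitting N n m V L W Q" and A: "A \<in> carrier_mat N N" and B: "B \<in> carrier_mat N p"
    and QA: "Q * A = c \<cdot>\<^sub>m Q" and QB: "Q * B = 0\<^sub>m m p"
    and X0: "\<And>x. x \<in> X0 \<Longrightarrow> Q *\<^sub>v x = 0\<^sub>v m"
  shows "low_dimensional td N p n X0 V A B"
proof -
  interpret splitting N n m V L W Q by fact
  have step: "Q *\<^sub>v (A *\<^sub>v x + B *\<^sub>v u) = c \<cdot>\<^sub>v (Q *\<^sub>v x)"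
    if x: "x \<in> carrier_vec N" and u: "u \<in> carrier_vec p" for x u
  proof -
    have "Q *\<^sub>v (A *\<^sub>v x + B *\<^sub>v u) = Q * A *\<^sub>v x + Q * B *\<^sub>v u"
      using assoc_mult_mat_vec[OF Q A x] assoc_mult_mat_vec[OF Q B u]
        mult_add_distrib_mat_vec[OF Q mult_mat_vec_carrier[OF A x] mult_mat_vec_carrier[OF B u]] by simp
    then show ?thesis
      using mult_mat_vec_carrier[OF Q x]
      by (simp add: QA QB zero_mult_mat_vec[OF u] smult_mat_mult_vec[OF Q x])
  qed
  show ?thesis
  proof (cases td)
    case Discrete
    have "\<exists>xh. \<forall>t. xh t \<in> carrier_vec n \<and> x t = V *\<^sub>v xh t"
      if tr: "trajectory_dt N p A B u x" and "x 0 \<in> X0" for u x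
    proof -
      have Qx: "Q *\<^sub>v x t = 0\<^sub>v m" for t
      proof (induction t)
        case (Suc t)
        moreover have "c \<cdot>\<^sub>v 0\<^sub>v m = 0\<^sub>v m" by (intro eq_vecI) auto
        ultimately show ?case using step[of "x t" "u t"] tr unfolding trajectory_dt_def by simp
      qed (use X0 that in simp)
      have "\<forall>t. \<exists>h. h \<in> carrier_vec n \<and> x t = V *\<^sub>v h"
        using range_iff Qx tr unfolding trajectory_dt_def by blast
      then show ?thesis by (rule choice)
    qed
    then show ?thesis unfolding low_dimensional_def Discrete by auto
  next
    case Continuous
    have "\<exists>xh. \<forall>t\<ge>0. xh t \<in> carrier_vec n \<and> x t = V *\<^sub>v xh t"
      if tr: "trajectory_ct N p A B u x" and x0: "x 0 \<in> X0" for u x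
    proof -
      have xc: "x t \<in> carrier_vec N" and uc: "u t \<in> carrier_vec p"
        and vel: "has_velocity N x (A *\<^sub>v x t + B *\<^sub>v u t) t" if "t \<ge> 0" for t
        using tr that unfolding trajectory_ct_def by auto
      have Qx: "Q *\<^sub>v x t = 0\<^sub>v m" if t: "t \<ge> 0" for t
      proof (rule eq_vecI)
        fix i assume "i < dim_vec (0\<^sub>v m :: real vec)"
        then have i: "i < m" by simp
        have "(Q *\<^sub>v x t) $ i = 0"
        proof (rule scalar_linear_ode_zero[where g = "\<lambda>t. (Q *\<^sub>v x t) $ i" and c = c, OF _ _ t])
          fix s :: real assume s: "s \<ge> 0"
          have "has_velocity m (\<lambda>s. Q *\<^sub>v x s) (c \<cdot>\<^sub>v (Q *\<^sub>v x s)) s"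
            using has_velocity_mult_mat[OF Q vel[OF s] s xc] step[OF xc[OF s] uc[OF s]] by simp
          then show "((\<lambda>t. (Q *\<^sub>v x t) $ i) has_real_derivative c * (Q *\<^sub>v x s) $ i) (at s within {0..})"
            using i carrier_matD(1)[OF Q] unfolding has_velocity_def by auto
        qed (use X0[OF x0] i in simp)
        then show "(Q *\<^sub>v x t) $ i = 0\<^sub>v m $ i" using i by simp
      qed (use carrier_matD(1)[OF Q] in simp)
      \<comment> \<open>The time restriction stands inside the existential so that choice yields a
        function on all of the reals.\<close>
      have "\<forall>t. \<exists>h. t \<ge> 0 \<longrightarrow> h \<in> carrier_vec n \<and> x t = V *\<^sub>v h"
        using range_iff Qx xc by blast
      then show ?thesis by (rule choice)
    qed
    then show ?thesis unfolding low_dimensional_def Continuous by auto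
  qed
qed

section \<open>Data equations and compatible models\<close>

lemma mat_of_cols_eq_mult_add:
  assumes A: "A \<in> carrier_mat N N" and B: "B \<in> carrier_mat N p"
    and "\<And>j. j < T \<Longrightarrow> x j \<in> carrier_vec N \<and> u j \<in> carrier_vec p \<and> y j = A *\<^sub>v x j + B *\<^sub>v u j"
  shows "mat_of_cols N (map y [0..<T])
    = A * mat_of_cols N (map x [0..<T]) + B * mat_of_cols p (map u [0..<T])" (is "?Y = A * ?X + B * ?U")
proof (rule eq_matI)
  have X: "?X \<in> carrier_mat N T" and U: "?U \<in> carrier_mat p T" by auto
  show "dim_row ?Y = dim_row (A * ?X + B * ?U)" "dim_col ?Y = dim_col (A * ?X + B * ?U)"
    using A B by auto
  fix i j assume "i < dim_row (A * ?X + B * ?U)" "j < dim_col (A * ?X + B * ?U)"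
  then have ij: "i < N" "j < T" using B by auto
  then show "?Y $$ (i, j) = (A * ?X + B * ?U) $$ (i, j)"
    using A B assms(3)[OF ij(2)] by (simp add: mat_of_cols_index)
qed

lemma data_sampledD:
  assumes A: "A \<in> carrier_mat N N" and B: "B \<in> carrier_mat N p"
    and data: "data_sampled td N p T X0 A B U Xm Xp"
  shows "U \<in> carrier_mat p T" "Xp = A * Xm + B * U"
proof -
  have "U \<in> carrier_mat p T \<and> Xp = A * Xm + B * U"
  proof (cases td)
    case Discrete
    then obtain u x where tr: "trajectory_dt N p A B u x"
      and eqs: "U = mat_of_cols p (map u [0..<T])" "Xm = mat_of_cols N (map x [0..<T])"
        "Xp = mat_of_cols N (map (\<lambda>j. x (Suc j)) [0..<T])"
      using data unfolding data_sampled_def by auto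
    then show ?thesis
      unfolding eqs using mat_of_cols_eq_mult_add[OF A B, of T x u "\<lambda>j. x (Suc j)"]
      unfolding trajectory_dt_def by auto
  next
    case Continuous
    then obtain u x \<tau> xd where tr: "trajectory_ct N p A B u x" and \<tau>: "\<tau> 0 = (0::real)"
        "\<forall>i j. i < j \<and> j < T \<longrightarrow> \<tau> i < \<tau> j" and xd: "\<forall>j<T. has_velocity N x (xd j) (\<tau> j)"
      and eqs: "U = mat_of_cols p (map (\<lambda>j. u (\<tau> j)) [0..<T])"
        "Xm = mat_of_cols N (map (\<lambda>j. x (\<tau> j)) [0..<T])" "Xp = mat_of_cols N (map xd [0..<T])"
      using data unfolding data_sampled_def by auto
    \<comment> \<open>The samples \<open>xd j\<close> are only known to be velocities of
      \<open>x\<close>; uniqueness of velocities identifies them with the right-hand side of the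
      model.\<close>
    have "x (\<tau> j) \<in> carrier_vec N \<and> u (\<tau> j) \<in> carrier_vec p \<and> xd j = A *\<^sub>v x (\<tau> j) + B *\<^sub>v u (\<tau> j)"
      if j: "j < T" for j
    proof -
      have "\<tau> j \<ge> 0" using \<tau>(1) \<tau>(2)[rule_format, of 0 j] j by (cases "j = 0") auto
      then show ?thesis using tr xd j has_velocity_unique unfolding trajectory_ct_def by blast
    qed
    then show ?thesis
      unfolding eqs using mat_of_cols_eq_mult_add[OF A B, of T "\<lambda>j. x (\<tau> j)" "\<lambda>j. u (\<tau> j)" xd] by auto
  qed
  then show "U \<in> carrier_mat p T" "Xp = A * Xm + B * U" by auto
qed

text \<open>Adding a rank-one matrix with row direction \<xi> to \<open>A\<close> leaves the data
  equation intact, and a suitable one makes \<xi> a fixed vector of the closed loop, contrary to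
  stability. One compatible model must be given, since otherwise the inclusion \<open>sub\<close>
  would be vacuous.\<close>

lemma informative_left_kernel_trivial:
  assumes AB: "(A, B) \<in> Sigma_is n p U Xm Xp" and Xm: "Xm \<in> carrier_mat n T" and U: "U \<in> carrier_mat p T"
    and K: "K \<in> carrier_mat p n" and sub: "Sigma_is n p U Xm Xp \<subseteq> Sigma_fb td n p K"
    and \<xi>: "\<xi> \<in> carrier_vec n" and ker: "\<And>j. j < T \<Longrightarrow> \<xi> \<bullet> col Xm j = 0"
  shows "\<xi> = 0\<^sub>v n"
proof (rule ccontr)
  assume nz: "\<xi> \<noteq> 0\<^sub>v n"
  have A: "A \<in> carrier_mat n n" and B: "B \<in> carrier_mat n p" and Xp: "Xp = A * Xm + B * U"
    using AB unfolding Sigma_is_def by auto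
  have s: "\<xi> \<bullet> \<xi> \<noteq> 0" using scalar_prod_self_eq_0[OF \<xi>] nz by blast
  have BK: "B * K \<in> carrier_mat n n" using B K by (rule mult_carrier_mat)
  \<comment> \<open>Solves \<open>A \<xi> + (\<xi> \<bullet> \<xi>) w + B K \<xi> = \<xi>\<close>
    for \<open>w\<close>, where the middle term is the rank-one matrix \<open>R\<close> applied to
    \<xi>.\<close>
  define w where "w = (1 / (\<xi> \<bullet> \<xi>)) \<cdot>\<^sub>v (\<xi> - (A *\<^sub>v \<xi> + B * K *\<^sub>v \<xi>))"
  define R where "R = mat n n (\<lambda>(i, j). w $ i * \<xi> $ j)"
  have R: "R \<in> carrier_mat n n" by (simp add: R_def)
  have row_R: "row R i = w $ i \<cdot>\<^sub>v \<xi>" if "i < n" for i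
    using that \<xi> by (intro eq_vecI) (auto simp: R_def)
  have RX: "R * Xm = 0\<^sub>m n T"
  proof (rule eq_matI)
    fix i j assume "i < dim_row (0\<^sub>m n T :: real mat)" "j < dim_col (0\<^sub>m n T :: real mat)"
    then show "(R * Xm) $$ (i, j) = 0\<^sub>m n T $$ (i, j)"
      using R Xm \<xi> ker by (simp add: row_R)
  qed (use R Xm in auto)
  have AX: "A * Xm \<in> carrier_mat n T" using A Xm by (rule mult_carrier_mat)
  have "(A + R) * Xm = A * Xm" using add_mult_distrib_mat[OF A R Xm] AX by (simp add: RX)
  then have "(A + R, B) \<in> Sigma_is n p U Xm Xp"
    using A B R Xp unfolding Sigma_is_def by simp
  then have "stable td (A + R + B * K)" using sub unfolding Sigma_fb_def by auto
  moreover have "(A + R + B * K) *\<^sub>v \<xi> = \<xi>"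
  proof -
    have "R *\<^sub>v \<xi> = \<xi> - (A *\<^sub>v \<xi> + B * K *\<^sub>v \<xi>)"
    proof (rule eq_vecI)
      fix i assume "i < dim_vec (\<xi> - (A *\<^sub>v \<xi> + B * K *\<^sub>v \<xi>))"
      then have i: "i < n" using B by simp
      have "(R *\<^sub>v \<xi>) $ i = w $ i * (\<xi> \<bullet> \<xi>)" using i R \<xi> by (simp add: row_R)
      also have "\<dots> = (\<xi> - (A *\<^sub>v \<xi> + B * K *\<^sub>v \<xi>)) $ i"
        unfolding w_def using i B \<xi> s by (subst index_smult_vec(1)) auto
      finally show "(R *\<^sub>v \<xi>) $ i = (\<xi> - (A *\<^sub>v \<xi> + B * K *\<^sub>v \<xi>)) $ i" .
    qed (use R B in auto)
    moreover have "(A + R + B * K) *\<^sub>v \<xi> = A *\<^sub>v \<xi> + R *\<^sub>v \<xi> + B * K *\<^sub>v \<xi>"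
      using add_mult_distrib_mat_vec[OF add_carrier_mat[OF R] BK \<xi>, of A]
        add_mult_distrib_mat_vec[OF A R \<xi>] by simp
    moreover have "a + (\<xi> - (a + b)) + b = \<xi>" if "a \<in> carrier_vec n" "b \<in> carrier_vec n" for a b
      using \<xi> that by (intro eq_vecI) auto
    ultimately show ?thesis
      using mult_mat_vec_carrier[OF A \<xi>] mult_mat_vec_carrier[OF BK \<xi>] by metis
  qed
  ultimately show False
    using not_stable_fixed_vector[of "A + R + B * K" n \<xi>] BK \<xi> nz add_carrier_mat[OF BK] by blast
qed

text \<open>Multiplying the full data equation by \<open>L\<close> cancels \<open>V\<close> in front
  of \<open>Xhp\<close>. Applied to the generating model, this shows that the set of reduced models
  is nonempty.\<close>

lemma reduced_model_in_Sigma_is: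
  assumes sp: "splitting N n m V L W Q"
    and A: "A \<in> carrier_mat N N" and B: "B \<in> carrier_mat N p"
    and A1: "A1 \<in> carrier_mat n n" and B1: "B1 \<in> carrier_mat n p"
    and Xhm: "Xhm \<in> carrier_mat n T" and Xhp: "Xhp \<in> carrier_mat n T" and U: "U \<in> carrier_mat p T"
    and LAV: "L * (A * V) = A1" and LB: "L * B = B1"
    and data: "V * Xhp = A * (V * Xhm) + B * U"
  shows "(A1, B1) \<in> Sigma_is n p U Xhm Xhp"
proof -
  interpret splitting N n m V L W Q by fact
  have VX: "V * Xhm \<in> carrier_mat N T" using V Xhm by (rule mult_carrier_mat)
  have AV: "A * V \<in> carrier_mat N n" using A V by (rule mult_carrier_mat)
  have "Xhp = L * (V * Xhp)" using assoc_mult_mat[OF L V Xhp] Xhp by (simp add: LV)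
  also have "\<dots> = L * (A * (V * Xhm)) + L * (B * U)"
    unfolding data
    by (rule mult_add_distrib_mat[OF L mult_carrier_mat[OF A VX] mult_carrier_mat[OF B U]])
  also have "L * (A * (V * Xhm)) = A1 * Xhm"
    using assoc_mult_mat[OF A V Xhm] assoc_mult_mat[OF L AV Xhm] by (simp add: LAV)
  also have "L * (B * U) = B1 * U" using assoc_mult_mat[OF L B U] by (simp add: LB)
  finally show ?thesis using A1 B1 unfolding Sigma_is_def by simp
qed

section \<open>Lifting and restricting controllers\<close>

lemma closed_loop_mult:
  assumes A: "A \<in> carrier_mat N N" and B1: "B1 \<in> carrier_mat n p" and V: "V \<in> carrier_mat N n"
    and A1: "A1 \<in> carrier_mat n n" and K: "K \<in> carrier_mat p N"
    and AV: "A * V = V * A1"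
  shows "(A + V * B1 * K) * V = V * (A1 + B1 * (K * V))"
proof -
  have VB: "V * B1 \<in> carrier_mat N p" using V B1 by (rule mult_carrier_mat)
  have KV: "K * V \<in> carrier_mat p n" using K V by (rule mult_carrier_mat)
  have "(A + V * B1 * K) * V = A * V + V * B1 * K * V"
    by (rule add_mult_distrib_mat[OF A mult_carrier_mat[OF VB K] V])
  also have "V * B1 * K * V = V * (B1 * (K * V))"
    using assoc_mult_mat[OF VB K V] assoc_mult_mat[OF V B1 KV] by simp
  also have "A * V + \<dots> = V * (A1 + B1 * (K * V))"
    unfolding AV using mult_add_distrib_mat[OF V A1 mult_carrier_mat[OF B1 KV]] by simp
  finally show ?thesis .
qed

text \<open>Low-dimensionality alone controls \<open>A\<close> only on reachable states. Full row
  rank of \<open>Xhm\<close>, a consequence of informativity, is what makes the whole range of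
  \<open>V\<close> invariant under \<open>A\<close>, so that the closed loop is block
  triangular.\<close>

lemma lifted_controller_stabilizes:
  assumes sp: "splitting N n m V L W (mp_inverse W)" and X0: "linear_subspace N X0"
    and Xhm: "Xhm \<in> carrier_mat n T" and Xhp: "Xhp \<in> carrier_mat n T" and U: "U \<in> carrier_mat p T"
    and nonempty: "(Ah, Bh) \<in> Sigma_is n p U Xhm Xhp"
    and Kh: "Kh \<in> carrier_mat p n" and sub: "Sigma_is n p U Xhm Xhp \<subseteq> Sigma_fb td n p Kh"
    and Vd: "Vd \<in> carrier_mat n N" "Vd * V = 1\<^sub>m n"
  shows "Sigma_is_s td N p n X0 U (V * Xhm) (V * Xhp) V W \<subseteq> Sigma_fb td N p (Kh * Vd)"
proof
  fix AB assume "AB \<in> Sigma_is_s td N p n X0 U (V * Xhm) (V * Xhp) V W"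
  then obtain A B where AB: "AB = (A, B)"
    and A: "A \<in> carrier_mat N N" and B: "B \<in> carrier_mat N p"
    and data: "V * Xhp = A * (V * Xhm) + B * U"
    and low: "low_dimensional td N p n X0 V A B" and st: "stable td (mp_inverse W * A * W)"
    unfolding Sigma_is_s_def Sigma_is_def by auto
  define Q where "Q = mp_inverse W"
  interpret splitting N n m V L W Q unfolding Q_def by (rule sp)
  have sp': "splitting N n m V L W Q" by unfold_locales
  have QB: "Q * B = 0\<^sub>m m p" by (rule low_dimensional_input_range[OF sp' A B low X0])
  have VX: "V * Xhm \<in> carrier_mat N T" using V Xhm by (rule mult_carrier_mat)
  have AV: "A * V \<in> carrier_mat N n" using A V by (rule mult_carrier_mat)
  have QAV_carrier: "Q * (A * V) \<in> carrier_mat m n" using Q AV by (rule mult_carrier_mat)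
  have "Q * (A * V) * Xhm = Q * (A * (V * Xhm))"
    using assoc_mult_mat[OF A V Xhm] assoc_mult_mat[OF Q AV Xhm] by simp
  \<comment> \<open>The added term vanishes by \<open>QB\<close>; it completes the right-hand side
    of the data equation, which \<open>Q\<close> maps to zero because \<open>Xp\<close> has its
    columns in the range of \<open>V\<close>.\<close>
  also have "\<dots> = Q * (A * (V * Xhm)) + Q * (B * U)"
    using assoc_mult_mat[OF Q B U] left_mult_zero_mat[OF U]
      right_add_zero_mat[OF mult_carrier_mat[OF Q mult_carrier_mat[OF A VX]]] by (simp add: QB)
  also have "\<dots> = Q * (V * Xhp)"
    unfolding data
    by (rule mult_add_distrib_mat[OF Q mult_carrier_mat[OF A VX] mult_carrier_mat[OF B U], symmetric])
  also have "\<dots> = 0\<^sub>m m T" using assoc_mult_mat[OF Q V Xhp] left_mult_zero_mat[OF Xhp] by (simp add: QV)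
  finally have QAVX: "Q * (A * V) * Xhm = 0\<^sub>m m T" .
  \<comment> \<open>By \<open>QAVX\<close>, each row of \<open>Q * (A * V)\<close> is in the left
    kernel of \<open>Xhm\<close>.\<close>
  have row0: "row (Q * (A * V)) i = 0\<^sub>v n" if i: "i < m" for i
  proof (rule informative_left_kernel_trivial[OF nonempty Xhm U Kh sub])
    show "row (Q * (A * V)) i \<in> carrier_vec n" using QAV_carrier i by auto
    show "row (Q * (A * V)) i \<bullet> col Xhm j = 0" if j: "j < T" for j
    proof -
      have "(Q * (A * V) * Xhm) $$ (i, j) = row (Q * (A * V)) i \<bullet> col Xhm j"
        by (rule index_mult_mat(1)) (use i j QAV_carrier Xhm in auto)
      then show ?thesis using i j by (simp add: QAVX)
    qed
  qed
  have "Q * (A * V) = 0\<^sub>m m n"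
  proof (rule eq_matI)
    fix i j assume ij: "i < dim_row (0\<^sub>m m n :: real mat)" "j < dim_col (0\<^sub>m m n :: real mat)"
    then have "(Q * (A * V)) $$ (i, j) = row (Q * (A * V)) i $ j"
      using carrier_matD[OF QAV_carrier] by (intro index_row(1)[symmetric]) auto
    then show "(Q * (A * V)) $$ (i, j) = 0\<^sub>m m n $$ (i, j)" using row0 ij by simp
  qed (use carrier_matD[OF QAV_carrier] in auto)
  then have AV_eq: "A * V = V * (L * (A * V))" by (rule range_mat[OF AV])
  have B_eq: "B = V * (L * B)" by (rule range_mat[OF B QB])
  define A1 B1 where "A1 = L * (A * V)" and "B1 = L * B"
  have A1: "A1 \<in> carrier_mat n n" unfolding A1_def using L AV by (rule mult_carrier_mat)
  have B1: "B1 \<in> carrier_mat n p" unfolding B1_def using L B by (rule mult_carrier_mat)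
  have KV: "Kh * Vd \<in> carrier_mat p N" using Kh Vd(1) by (rule mult_carrier_mat)
  have BK: "B * (Kh * Vd) \<in> carrier_mat N N" using B KV by (rule mult_carrier_mat)
  define M where "M = A + B * (Kh * Vd)"
  have M: "M \<in> carrier_mat N N" unfolding M_def using BK by (rule add_carrier_mat)
  have "(A1, B1) \<in> Sigma_is n p U Xhm Xhp"
    by (rule reduced_model_in_Sigma_is[OF sp' A B A1 B1 Xhm Xhp U _ _ data]) (simp_all add: A1_def B1_def)
  then have st1: "stable td (A1 + B1 * Kh)" using sub unfolding Sigma_fb_def by auto
  have "Kh * Vd * V = Kh" using assoc_mult_mat[OF Kh Vd(1) V] Vd(2) Kh by simp
  then have MV: "M * V = V * (A1 + B1 * Kh)"
    using closed_loop_mult[OF A B1 V A1 KV AV_eq[folded A1_def]] B_eq[folded B1_def]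
    unfolding M_def by simp
  \<comment> \<open>Feedback enters through \<open>B\<close>, which \<open>Q\<close> annihilates, so
    the complementary diagonal block is the open-loop one and is stable by membership in
    \<open>Sigma_is_s\<close>.\<close>
  have "Q * M = Q * A"
    unfolding M_def using mult_add_distrib_mat[OF Q A BK] assoc_mult_mat[OF Q B KV]
      left_mult_zero_mat[OF KV] right_add_zero_mat[OF mult_carrier_mat[OF Q A]] by (simp add: QB)
  then have "stable td (Q * M * W)" using st by (simp add: Q_def)
  then have "stable td M"
    by (rule stable_block_triangular[OF sp' M add_carrier_mat[OF mult_carrier_mat[OF B1 Kh]] MV st1])
  then show "AB \<in> Sigma_fb td N p (Kh * Vd)"
    unfolding AB Sigma_fb_def M_def using A B by simp
qed

text \<open>A controller for the full models must also stabilize the lift of each reduced model. The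
  closed loop of the lift leaves the range of \<open>V\<close> invariant and acts there as the
  reduced closed loop with gain \<open>K * V\<close>.\<close>

lemma restricted_controller_stabilizes:
  assumes sp: "splitting N n m V L W (mp_inverse W)"
    and X0: "\<And>x. x \<in> X0 \<Longrightarrow> mp_inverse W *\<^sub>v x = 0\<^sub>v m"
    and Xhm: "Xhm \<in> carrier_mat n T" and Xhp: "Xhp \<in> carrier_mat n T" and U: "U \<in> carrier_mat p T"
    and K: "K \<in> carrier_mat p N"
    and sub: "Sigma_is_s td N p n X0 U (V * Xhm) (V * Xhp) V W \<subseteq> Sigma_fb td N p K"
  shows "Sigma_is n p U Xhm Xhp \<subseteq> Sigma_fb td n p (K * V)"
proof
  fix AB assume "AB \<in> Sigma_is n p U Xhm Xhp"
  then obtain Ah Bh where AB: "AB = (Ah, Bh)"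
    and Ah: "Ah \<in> carrier_mat n n" and Bh: "Bh \<in> carrier_mat n p" and data: "Xhp = Ah * Xhm + Bh * U"
    unfolding Sigma_is_def by auto
  define Q where "Q = mp_inverse W"
  interpret splitting N n m V L W Q unfolding Q_def by (rule sp)
  have sp': "splitting N n m V L W Q" by unfold_locales
  \<comment> \<open>The eigenvalue assigned to the complement must lie in the stability region, and
    0 does so only in discrete time.\<close>
  define c :: real where "c = (case td of Discrete \<Rightarrow> 0 | Continuous \<Rightarrow> - 1)"
  \<comment> \<open>The lift acts as \<open>Ah\<close> on the range of \<open>V\<close> and as
    multiplication by \<open>c\<close> on the range of \<open>W\<close>.\<close>
  define A B where "A = V * (Ah * L) + W * (c \<cdot>\<^sub>m Q)" and "B = V * Bh"
  have AL: "Ah * L \<in> carrier_mat n N" using Ah L by (rule mult_carrier_mat)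
  have cQ: "c \<cdot>\<^sub>m Q \<in> carrier_mat m N" by simp
  have VAL: "V * (Ah * L) \<in> carrier_mat N N" using V AL by (rule mult_carrier_mat)
  have WcQ: "W * (c \<cdot>\<^sub>m Q) \<in> carrier_mat N N" using W cQ by (rule mult_carrier_mat)
  have A: "A \<in> carrier_mat N N" unfolding A_def using WcQ by (rule add_carrier_mat)
  have B: "B \<in> carrier_mat N p" unfolding B_def using V Bh by (rule mult_carrier_mat)
  have QB: "Q * B = 0\<^sub>m m p" unfolding B_def using assoc_mult_mat[OF Q V Bh] left_mult_zero_mat[OF Bh] by (simp add: QV)
  have QA: "Q * A = c \<cdot>\<^sub>m Q"
  proof -
    have "Q * A = Q * (V * (Ah * L)) + Q * (W * (c \<cdot>\<^sub>m Q))"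
      unfolding A_def by (rule mult_add_distrib_mat[OF Q VAL WcQ])
    then show ?thesis
      using assoc_mult_mat[OF Q V AL] assoc_mult_mat[OF Q W cQ] left_mult_zero_mat[OF AL]
        left_mult_one_mat[OF cQ] left_add_zero_mat[OF cQ] by (simp add: QV QW)
  qed
  have AV: "A * V = V * Ah"
  proof -
    have "A * V = V * (Ah * L) * V + W * (c \<cdot>\<^sub>m Q) * V"
      unfolding A_def by (rule add_mult_distrib_mat[OF VAL WcQ V])
    also have "V * (Ah * L) * V = V * Ah"
      using assoc_mult_mat[OF V AL V] assoc_mult_mat[OF Ah L V] Ah by (simp add: LV)
    also have "W * (c \<cdot>\<^sub>m Q) * V = W * (c \<cdot>\<^sub>m (Q * V))"
      using assoc_mult_mat[OF W cQ V] mult_smult_assoc_mat[OF Q V] by simp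
    also have "c \<cdot>\<^sub>m (Q * V) = 0\<^sub>m m n" by (simp add: QV)
    finally show ?thesis
      using right_mult_zero_mat[OF W] right_add_zero_mat[OF mult_carrier_mat[OF V Ah]] by simp
  qed
  have "V * Xhp = A * (V * Xhm) + B * U"
  proof -
    have "V * Xhp = V * (Ah * Xhm) + V * (Bh * U)"
      unfolding data
      by (rule mult_add_distrib_mat[OF V mult_carrier_mat[OF Ah Xhm] mult_carrier_mat[OF Bh U]])
    then show ?thesis
      unfolding B_def using assoc_mult_mat[OF V Ah Xhm] assoc_mult_mat[OF V Bh U]
        assoc_mult_mat[OF A V Xhm] by (simp add: AV)
  qed
  moreover have "low_dimensional td N p n X0 V A B"
    by (rule low_dimensionalI[OF sp' A B QA QB]) (use X0 Q_def in simp)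
  moreover have "stable td (Q * A * W)"
  proof -
    have "Q * A * W = c \<cdot>\<^sub>m 1\<^sub>m m"
      unfolding QA using mult_smult_assoc_mat[OF Q W] by (simp add: QW)
    then show ?thesis
      using stable_smult_one[where td = td and c = c and m = m] by (cases td) (simp_all add: c_def)
  qed
  ultimately have "(A, B) \<in> Sigma_is_s td N p n X0 U (V * Xhm) (V * Xhp) V W"
    using A B unfolding Sigma_is_s_def Sigma_is_def Q_def by simp
  then have st: "stable td (A + B * K)" using sub unfolding Sigma_fb_def by auto
  have M: "A + B * K \<in> carrier_mat N N" by (rule add_carrier_mat[OF mult_carrier_mat[OF B K]])
  have M1: "Ah + Bh * (K * V) \<in> carrier_mat n n"
    by (rule add_carrier_mat[OF mult_carrier_mat[OF Bh mult_carrier_mat[OF K V]]])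
  have "stable td (Ah + Bh * (K * V))"
    by (rule stable_compression[OF sp' M M1 _ st]) (use closed_loop_mult[OF A Bh V Ah K AV] in \<open>simp add: B_def\<close>)
  then show "AB \<in> Sigma_fb td n p (K * V)"
    using Ah Bh unfolding AB Sigma_fb_def by simp
qed

theorem theorem2:
  fixes td :: time_domain
    and N n p T :: nat
    and X0 :: "real vec set"
    and A0 B0 V Vp U Xm Xp Xhm Xhp :: "real mat"
  assumes "n \<le> N"
    and "linear_subspace N X0"
    and "V \<in> carrier_mat N n" and "vec_space.rank N V = n"
    and "basis_matrix N (vec_module.orthogonal_complement N (vec_space.col_space N V)) Vp"
    and "A0 \<in> carrier_mat N N" and "B0 \<in> carrier_mat N p"
    and "data_sampled td N p T X0 A0 B0 U Xm Xp"
    and "low_dimensional td N p n X0 V A0 B0"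
    and "Xhm \<in> carrier_mat n T" and "Xm = V * Xhm"
    and "Xhp \<in> carrier_mat n T" and "Xp = V * Xhp"
  shows "((\<exists>K\<in>carrier_mat p N. Sigma_is_s td N p n X0 U Xm Xp V Vp \<subseteq> Sigma_fb td N p K)
            \<longleftrightarrow> informative_for_stabilization td n p U Xhm Xhp)
       \<and> (\<forall>Kh\<in>carrier_mat p n. Sigma_is n p U Xhm Xhp \<subseteq> Sigma_fb td n p Kh \<longrightarrow>
            (\<forall>Vd\<in>carrier_mat n N. Vd * V = 1\<^sub>m n \<longrightarrow>
               Sigma_is_s td N p n X0 U Xm Xp V Vp \<subseteq> Sigma_fb td N p (Kh * Vd)))"
proof -
  note A0 = assms(6) and B0 = assms(7) and Xhm = assms(10) and Xhp = assms(12)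
  obtain L where sp: "splitting N n (dim_col Vp) V L Vp (mp_inverse Vp)"
    by (rule orthogonal_complement_splitting[OF assms(3-5)])
  interpret splitting N n "dim_col Vp" V L Vp "mp_inverse Vp" by (rule sp)
  have U: "U \<in> carrier_mat p T" and data: "V * Xhp = A0 * (V * Xhm) + B0 * U"
    using data_sampledD[OF A0 B0 assms(8)] assms(11,13) by auto
  \<comment> \<open>Low-dimensionality of the generating model, read at time 0, puts
    \<open>X0\<close> in the range of \<open>V\<close>; the lifted models need this in order to be
    low-dimensional themselves.\<close>
  have X0: "mp_inverse Vp *\<^sub>v x = 0\<^sub>v (dim_col Vp)" if "x \<in> X0" for x
    by (rule low_dimensionalD(1)[OF sp A0 B0 assms(9), where u = "0\<^sub>v p"])
      (use that linear_subspaceD[OF assms(2)] in auto)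
  have nonempty: "(L * (A0 * V), L * B0) \<in> Sigma_is n p U Xhm Xhp"
    by (rule reduced_model_in_Sigma_is[OF sp A0 B0 _ _ Xhm Xhp U refl refl data])
      (intro mult_carrier_mat[OF L] mult_carrier_mat[OF A0 V] B0)+
  have lift: "Sigma_is_s td N p n X0 U Xm Xp V Vp \<subseteq> Sigma_fb td N p (Kh * Vd)"
    if "Kh \<in> carrier_mat p n" "Sigma_is n p U Xhm Xhp \<subseteq> Sigma_fb td n p Kh"
      "Vd \<in> carrier_mat n N" "Vd * V = 1\<^sub>m n" for Kh Vd
    unfolding assms(11,13) by (rule lifted_controller_stabilizes[OF sp assms(2) Xhm Xhp U nonempty that])
  moreover have "informative_for_stabilization td n p U Xhm Xhp"
    if "K \<in> carrier_mat p N" "Sigma_is_s td N p n X0 U Xm Xp V Vp \<subseteq> Sigma_fb td N p K" for K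
    unfolding informative_for_stabilization_def
    using restricted_controller_stabilizes[OF sp X0 Xhm Xhp U that(1) that(2)[unfolded assms(11,13)]]
      mult_carrier_mat[OF that(1) V] by blast
  \<comment> \<open>For existence, the left inverse \<open>L\<close> from the splitting serves as
    \<open>Vd\<close>.\<close>
  moreover have "\<exists>K\<in>carrier_mat p N. Sigma_is_s td N p n X0 U Xm Xp V Vp \<subseteq> Sigma_fb td N p K"
    if "informative_for_stabilization td n p U Xhm Xhp"
    using that lift[OF _ _ L LV] mult_carrier_mat[OF _ L]
    unfolding informative_for_stabilization_def by blast
  ultimately show ?thesis by blast
qed

end
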